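(* Let $AX=B$, where all entries of $X\in\mathbb{R}^{n\times m}$ are nonzero, $A\in\mathbb{R}^{n\times n}$ is a nonsingular $\{1;1\}$-quasiseparable matrix with a tangent-Givens-vector representation $\Omega_{GV}$ and a quasiseparable representation $\Omega_{QS}$, and $B=\sum_{k=1}^M\omega_k^BS_k\in\mathbb{R}^{n\times m}$ has a sparse representation with parameter vector $\Omega_B=(\omega_1^B,\dots,\omega_M^B)$. Assume $\Omega_{QS}\cap\Omega_B=\emptyset$ and $\Omega_{GV}\cap\Omega_B=\emptyset$ (the parameters of $A$ and of $B$ are independent). Then $$\mathscr{K}^{GV}_{|\Omega_B|}\le\mathscr{K}^{QS}_{|\Omega_B|}\le(3n-2)\,\mathscr{K}^{GV}_{|\Omega_B|}.$$
   Context: Let $n\ge2$. A quasiseparable representation of a $\{1;1\}$-quasiseparable matrix $A\in\mathbb{R}^{n\times n}$ is a vector of $7n-8$ real parameters $\Omega_{QS}=(\{p_i\}_{i=2}^n,\{a_i\}_{i=2}^{n-1},\{q_i\}_{i=1}^{n-1},\{d_i\}_{i=1}^n,\{g_i\}_{i=1}^{n-1},\{b_i\}_{i=2}^{n-1},\{h_i\}_{i=2}^n)$ with $A(i,i)=d_i$, $A(i,j)=p_ia_{i-1}a_{i-2}\cdots a_{j+1}q_j$ for $i>j$, and $A(i,j)=g_ib_{i+1}b_{i+2}\cdots b_{j-1}h_j$ for $i<j$ (empty products equal 1); $A$ is $\{1;1\}$-quasiseparable if and only if it has such a representation. A tangent-Givens-vector representation of $A$ is a vector of $5n-6$ real parameters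 $\Omega_{GV}=(\{l_i\}_{i=2}^{n-1},\{v_i\}_{i=1}^{n-1},\{d_i\}_{i=1}^n,\{w_i\}_{i=1}^{n-1},\{u_i\}_{i=2}^{n-1})$ such that, with $c_i=1/\sqrt{1+l_i^2}$, $s_i=l_i/\sqrt{1+l_i^2}$, $r_i=1/\sqrt{1+u_i^2}$, $t_i=u_i/\sqrt{1+u_i^2}$ for $i=2,\dots,n-1$ and $c_n:=r_n:=1$, one has $A(i,i)=d_i$, $A(i,j)=c_is_{i-1}\cdots s_{j+1}v_j$ for $i>j$, and $A(i,j)=w_it_{i+1}\cdots t_{j-1}r_j$ for $i<j$. Sparse representation of $B$: $B=\sum_{k=1}^M\omega_k^BS_k$, where the $S_k\in\mathbb{R}^{n\times m}$ are fixed constant matrices (typically with entries 0 and 1) and $\Omega_B=(\omega^B_1,\dots,\omega^B_M)$ are independent real parameters, independent of those of $A$. $|Z|$ denotes the entrywise absolute value, $\|Z\|_{\max}=\max_{i,j}|z_{ij}|$, inequalities are entrywise. For $\Omega\in\{\Omega_{QS},\Omega_{GV}\}$ define (with $\eta>0$) $$\mathscr{K}_{|\Omega|,|\Omega_B|}(A(\Omega),B(\Omega_B)):=\lim_{\eta\to0}\sup\left\{\frac1\eta\frac{\|\delta X\|_{\max}}{\|X\|_{\max}}: A(\Omega+\delta\Omega)(X+\delta X)=B(\Omega_B+\delta\Omega_B),\ |\delta\Omega|\le\eta|\Omega|,\ |\delta\Omega_B|\le\eta|\Omega_B|\right\},$$ and set $\mathscr{K}^{QS}_{|\Omega_B|}:=\mathscr{K}_{|\Omega_{QS}|,|\Omega_B|}(A(\Omega_{QS}),B(\Omega_B))$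 and $\mathscr{K}^{GV}_{|\Omega_B|}:=\mathscr{K}_{|\Omega_{GV}|,|\Omega_B|}(A(\Omega_{GV}),B(\Omega_B))$. *)

theory Defs
  imports "Jordan_Normal_Form.Determinant" "HOL-Library.Extended_Real"
begin

text \<open>
  Matrices are those of \<open>Jordan_Normal_Form\<close>, whose entries are indexed from \<open>0\<close>.
  Parameters keep the customary indices \<open>1, \<dots>, n\<close>, so entry \<open>(i, j)\<close> in the usual
  numbering is \<open>A $$ (i - 1, j - 1)\<close>.

  A parameter vector is a real function on a type of parameter names; only its values on an
  explicit finite set of names are parameters, and no other value enters the matrix (lemmas
  \<open>qs_matrix_cong\<close>, \<open>gv_matrix_cong\<close> and \<open>sparse_matrix_cong\<close>).
\<close>

datatype qs_name = QS_p nat | QS_a nat | QS_q nat | QS_d nat | QS_g nat | QS_b nat | QS_h nat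

definition qs_names :: "nat \<Rightarrow> qs_name set" where
  "qs_names n = QS_p ` {2..n} \<union> QS_a ` {2..n-1} \<union> QS_q ` {1..n-1} \<union> QS_d ` {1..n}
     \<union> QS_g ` {1..n-1} \<union> QS_b ` {2..n-1} \<union> QS_h ` {2..n}"

definition qs_entry :: "(qs_name \<Rightarrow> real) \<Rightarrow> nat \<Rightarrow> nat \<Rightarrow> real" where
  "qs_entry \<Omega> i j =
     (if i = j then \<Omega> (QS_d i)
      else if j < i then \<Omega> (QS_p i) * (\<Prod>k\<in>{j<..<i}. \<Omega> (QS_a k)) * \<Omega> (QS_q j)
      else \<Omega> (QS_g i) * (\<Prod>k\<in>{i<..<j}. \<Omega> (QS_b k)) * \<Omega> (QS_h j))"

definition qs_matrix :: "nat \<Rightarrow> (qs_name \<Rightarrow> real) \<Rightarrow> real mat" where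
  "qs_matrix n \<Omega> = mat n n (\<lambda>(i, j). qs_entry \<Omega> (Suc i) (Suc j))"

definition qs_representation :: "nat \<Rightarrow> real mat \<Rightarrow> (qs_name \<Rightarrow> real) \<Rightarrow> bool" where
  "qs_representation n M \<Omega> \<longleftrightarrow> M = qs_matrix n \<Omega>"

definition quasiseparable :: "nat \<Rightarrow> real mat \<Rightarrow> bool" where
  "quasiseparable n M \<longleftrightarrow> (\<exists>\<Omega>. qs_representation n M \<Omega>)"

datatype gv_name = GV_l nat | GV_v nat | GV_d nat | GV_w nat | GV_u nat

definition gv_names :: "nat \<Rightarrow> gv_name set" where
  "gv_names n = GV_l ` {2..n-1} \<union> GV_v ` {1..n-1} \<union> GV_d ` {1..n} \<union> GV_w ` {1..n-1} \<union> GV_u ` {2..n-1}"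

definition tan_cos :: "real \<Rightarrow> real" where
  "tan_cos x = 1 / sqrt (1 + x\<^sup>2)"

definition tan_sin :: "real \<Rightarrow> real" where
  "tan_sin x = x / sqrt (1 + x\<^sup>2)"

text \<open>
  The conventions \<open>c\<^sub>n = r\<^sub>n = 1\<close> are constants: they are not perturbed with the parameters.
\<close>

definition gv_c :: "nat \<Rightarrow> (gv_name \<Rightarrow> real) \<Rightarrow> nat \<Rightarrow> real" where
  "gv_c n \<Omega> i = (if i = n then 1 else tan_cos (\<Omega> (GV_l i)))"

definition gv_s :: "(gv_name \<Rightarrow> real) \<Rightarrow> nat \<Rightarrow> real" where
  "gv_s \<Omega> i = tan_sin (\<Omega> (GV_l i))"

definition gv_r :: "nat \<Rightarrow> (gv_name \<Rightarrow> real) \<Rightarrow> nat \<Rightarrow> real" where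
  "gv_r n \<Omega> j = (if j = n then 1 else tan_cos (\<Omega> (GV_u j)))"

definition gv_t :: "(gv_name \<Rightarrow> real) \<Rightarrow> nat \<Rightarrow> real" where
  "gv_t \<Omega> j = tan_sin (\<Omega> (GV_u j))"

definition gv_entry :: "nat \<Rightarrow> (gv_name \<Rightarrow> real) \<Rightarrow> nat \<Rightarrow> nat \<Rightarrow> real" where
  "gv_entry n \<Omega> i j =
     (if i = j then \<Omega> (GV_d i)
      else if j < i then gv_c n \<Omega> i * (\<Prod>k\<in>{j<..<i}. gv_s \<Omega> k) * \<Omega> (GV_v j)
      else \<Omega> (GV_w i) * (\<Prod>k\<in>{i<..<j}. gv_t \<Omega> k) * gv_r n \<Omega> j)"

definition gv_matrix :: "nat \<Rightarrow> (gv_name \<Rightarrow> real) \<Rightarrow> real mat" where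
  "gv_matrix n \<Omega> = mat n n (\<lambda>(i, j). gv_entry n \<Omega> (Suc i) (Suc j))"

definition gv_representation :: "nat \<Rightarrow> real mat \<Rightarrow> (gv_name \<Rightarrow> real) \<Rightarrow> bool" where
  "gv_representation n M \<Omega> \<longleftrightarrow> M = gv_matrix n \<Omega>"

text \<open>
  The sum of the matrices \<open>\<omega>\<^sub>k S\<^sub>k\<close>, \<open>1 \<le> k \<le> N\<close>, is written entrywise because matrices of all
  dimensions share one type, which has no zero element and hence no \<open>sum\<close>.
\<close>

definition sparse_matrix :: "nat \<Rightarrow> nat \<Rightarrow> nat \<Rightarrow> (nat \<Rightarrow> real mat) \<Rightarrow> (nat \<Rightarrow> real) \<Rightarrow> real mat" where
  "sparse_matrix n m N S \<omega> = mat n m (\<lambda>(i, j). \<Sum>k = 1..N. \<omega> k * S k $$ (i, j))"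

definition max_norm :: "real mat \<Rightarrow> real" where
  "max_norm Z = Max (abs ` elements_mat Z)"

text \<open>
  \<open>cond_number n m I F \<Omega> J R \<Psi> X\<close> is the relative condition number of the solution \<open>X\<close> (of size
  \<open>n\<close> by \<open>m\<close>) of \<open>F \<Omega> X = R \<Psi>\<close> with respect to the parameters of the coefficient matrix, named
  by \<open>I\<close>, and those of the right-hand side, named by \<open>J\<close>. The two families are perturbed
  separately, that is, no parameter is shared between them. The supremum is taken in the
  extended reals, since for large \<open>\<eta>\<close> the perturbed coefficient matrix may be singular and the
  quotients unbounded.
\<close>

definition cond_quotients ::
  "nat \<Rightarrow> nat \<Rightarrow> 'a set \<Rightarrow> (('a \<Rightarrow> real) \<Rightarrow> real mat) \<Rightarrow> ('a \<Rightarrow> real) \<Rightarrow>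
   'b set \<Rightarrow> (('b \<Rightarrow> real) \<Rightarrow> real mat) \<Rightarrow> ('b \<Rightarrow> real) \<Rightarrow> real mat \<Rightarrow> real \<Rightarrow> real set" where
  "cond_quotients n m I F \<Omega> J R \<Psi> X \<eta> =
     {1 / \<eta> * (max_norm \<delta>X / max_norm X) | \<delta>X \<delta>\<Omega> \<delta>\<Psi>.
        \<delta>X \<in> carrier_mat n m \<and>
        F (\<lambda>k. \<Omega> k + \<delta>\<Omega> k) * (X + \<delta>X) = R (\<lambda>k. \<Psi> k + \<delta>\<Psi> k) \<and>
        (\<forall>k\<in>I. \<bar>\<delta>\<Omega> k\<bar> \<le> \<eta> * \<bar>\<Omega> k\<bar>) \<and>
        (\<forall>k\<in>J. \<bar>\<delta>\<Psi> k\<bar> \<le> \<eta> * \<bar>\<Psi> k\<bar>)}"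

definition cond_number ::
  "nat \<Rightarrow> nat \<Rightarrow> 'a set \<Rightarrow> (('a \<Rightarrow> real) \<Rightarrow> real mat) \<Rightarrow> ('a \<Rightarrow> real) \<Rightarrow>
   'b set \<Rightarrow> (('b \<Rightarrow> real) \<Rightarrow> real mat) \<Rightarrow> ('b \<Rightarrow> real) \<Rightarrow> real mat \<Rightarrow> ereal" where
  "cond_number n m I F \<Omega> J R \<Psi> X =
     Lim (at_right 0) (\<lambda>\<eta>. Sup (ereal ` cond_quotients n m I F \<Omega> J R \<Psi> X \<eta>))"

definition cond_QS ::
  "nat \<Rightarrow> nat \<Rightarrow> (qs_name \<Rightarrow> real) \<Rightarrow> nat \<Rightarrow> (nat \<Rightarrow> real mat) \<Rightarrow> (nat \<Rightarrow> real) \<Rightarrow> real mat \<Rightarrow> ereal" where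
  "cond_QS n m \<Omega> N S \<omega> X =
     cond_number n m (qs_names n) (qs_matrix n) \<Omega> {1..N} (sparse_matrix n m N S) \<omega> X"

definition cond_GV ::
  "nat \<Rightarrow> nat \<Rightarrow> (gv_name \<Rightarrow> real) \<Rightarrow> nat \<Rightarrow> (nat \<Rightarrow> real mat) \<Rightarrow> (nat \<Rightarrow> real) \<Rightarrow> real mat \<Rightarrow> ereal" where
  "cond_GV n m \<Omega> N S \<omega> X =
     cond_number n m (gv_names n) (gv_matrix n) \<Omega> {1..N} (sparse_matrix n m N S) \<omega> X"

lemma card_qs_names: "n \<ge> 2 \<Longrightarrow> card (qs_names n) = 7 * n - 8"
  unfolding qs_names_def
  by (subst card_Un_disjoint; (auto simp: card_image inj_on_def)?)+

lemma card_gv_names: "n \<ge> 2 \<Longrightarrow> card (gv_names n) = 5 * n - 6"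
  unfolding gv_names_def
  by (subst card_Un_disjoint; (auto simp: card_image inj_on_def)?)+

lemma qs_matrix_cong:
  assumes "\<And>k. k \<in> qs_names n \<Longrightarrow> \<Omega> k = \<Omega>' k"
  shows "qs_matrix n \<Omega> = qs_matrix n \<Omega>'"
proof -
  have "qs_entry \<Omega> i j = qs_entry \<Omega>' i j" if "i \<in> {1..n}" "j \<in> {1..n}" for i j
    using that unfolding qs_entry_def
    by (auto intro!: arg_cong2[where f = "(*)"] prod.cong assms simp: qs_names_def)
  then show ?thesis
    unfolding qs_matrix_def by (intro cong_mat) auto
qed

lemma gv_matrix_cong:
  assumes "\<And>k. k \<in> gv_names n \<Longrightarrow> \<Omega> k = \<Omega>' k"
  shows "gv_matrix n \<Omega> = gv_matrix n \<Omega>'"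
proof -
  have "gv_entry n \<Omega> i j = gv_entry n \<Omega>' i j" if "i \<in> {1..n}" "j \<in> {1..n}" for i j
    using that unfolding gv_entry_def gv_c_def gv_s_def gv_r_def gv_t_def
    by (auto intro!: arg_cong2[where f = "(*)"] prod.cong assms arg_cong[where f = tan_cos]
        arg_cong[where f = tan_sin] simp: gv_names_def)
  then show ?thesis
    unfolding gv_matrix_def by (intro cong_mat) auto
qed

lemma sparse_matrix_cong:
  "(\<And>k. k \<in> {1..N} \<Longrightarrow> \<omega> k = \<omega>' k) \<Longrightarrow> sparse_matrix n m N S \<omega> = sparse_matrix n m N S \<omega>'"
  unfolding sparse_matrix_def by (intro cong_mat) auto

end

theory Submission
  imports Defs
begin

text \<open>
  Both condition numbers are, to first order, weighted \<open>l\<^sub>1\<close> norms of a gradient. Write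
  \<open>\<Omega>\<^sub>k (1 + \<epsilon>\<^sub>k)\<close> with \<open>\<bar>\<epsilon>\<^sub>k\<bar> \<le> \<eta>\<close> for the perturbed parameters of \<open>A\<close>, and similarly \<open>\<epsilon>'\<^sub>k\<close> for
  those of \<open>B\<close>. Then
  \<open>\<delta>X = A\<^sup>-\<^sup>1 (\<Sum>\<epsilon>'\<^sub>k \<omega>\<^sub>k S\<^sub>k - \<Sum>\<epsilon>\<^sub>k E\<^sub>k X) + o(\<eta>)\<close>,
  where \<open>E\<^sub>k = \<Omega>\<^sub>k \<partial>A/\<partial>\<Omega>\<^sub>k\<close>. The
  relative perturbations may have any signs, so entry \<open>(i, j)\<close> of \<open>\<delta>X\<close> can reach
  \<open>\<eta> (\<Sum>\<bar>(A\<^sup>-\<^sup>1 E\<^sub>k X)\<^sub>i\<^sub>j\<bar> + \<Sum>\<bar>(A\<^sup>-\<^sup>1 \<omega>\<^sub>k S\<^sub>k)\<^sub>i\<^sub>j\<bar>)\<close> up to \<open>o(\<eta>)\<close>, and no more. Hence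
  the limit that defines the condition number exists and equals the largest of these
  sensitivities divided by the norm of \<open>X\<close> (\<open>perturbed_system.cond_number_eq\<close>). It remains to compare
  the sensitivities of the two representations entry by entry; the right-hand side contributes
  the same term to both.

  The matrices \<open>E\<^sub>k\<close> can be read off from \<open>A\<close>, because every entry is a product of functions of
  single parameters. In the strictly lower triangle, the quasiseparable parameters give the rows
  \<open>R\<^sub>k\<close>, the columns \<open>C\<^sub>k\<close> and the blocks \<open>B\<^sub>k\<close> (rows below \<open>k\<close>, columns before \<open>k\<close>). The tangent
  \<open>l\<^sub>k\<close> enters row \<open>k\<close> through a cosine and the block through a sine, and therefore gives
  \<open>c\<^sub>k\<^sup>2 B\<^sub>k - s\<^sub>k\<^sup>2 R\<^sub>k\<close>; the columns \<open>C\<^sub>k\<close> stay the same. The triangle inequality and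
  \<open>c\<^sub>k\<^sup>2 + s\<^sub>k\<^sup>2 = 1\<close> yield the first inequality.

  For the second one, rows and blocks have to be recovered from the combinations
  \<open>G\<^sub>k = c\<^sub>k\<^sup>2 B\<^sub>k - s\<^sub>k\<^sup>2 R\<^sub>k\<close> and the columns. The lower left corner \<open>H\<^sub>k\<close>
  (rows from \<open>k\<close> on, columns before \<open>k\<close>) satisfies \<open>H\<^sub>k = R\<^sub>k + B\<^sub>k\<close> and
  \<open>H\<^sub>k\<^sub>+\<^sub>1 = B\<^sub>k + C\<^sub>k\<close>. So \<open>B\<^sub>k = s\<^sub>k\<^sup>2 H\<^sub>k + G\<^sub>k\<close>, \<open>R\<^sub>k = c\<^sub>k\<^sup>2 H\<^sub>k - G\<^sub>k\<close> and
  \<open>H\<^sub>k\<^sub>+\<^sub>1 = s\<^sub>k\<^sup>2 H\<^sub>k + G\<^sub>k + C\<^sub>k\<close>: the corners never exceed the sum of all \<open>\<bar>G\<^sub>i\<bar>\<close> and \<open>\<bar>C\<^sub>i\<bar>\<close>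
  (\<open>corner_recursion_bound\<close>). There are \<open>n - 1\<close> corners, which leads to the factor
  \<open>n + 1 \<le> 3 n - 2\<close>. The upper triangle is the transposed situation.
\<close>

section \<open>Expansions under relative perturbations\<close>

definition relatively_perturbed ::
  "'a set \<Rightarrow> ('a \<Rightarrow> real) \<Rightarrow> real \<Rightarrow> ('a \<Rightarrow> real) \<Rightarrow> ('a \<Rightarrow> real) \<Rightarrow> bool" where
  "relatively_perturbed I \<Omega> \<eta> \<epsilon> \<Omega>' \<longleftrightarrow> (\<forall>k\<in>I. \<bar>\<epsilon> k\<bar> \<le> \<eta> \<and> \<Omega>' k = \<Omega> k * (1 + \<epsilon> k))"

text \<open>
  The vector \<open>E\<close> is the gradient with respect to relative perturbations: \<open>E k\<close> is \<open>\<Omega> k\<close> times the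
  \<open>k\<close>-th partial derivative. The parameter vectors do not form a normed space, so
  differentiability is spelled out. The remainder is uniform over all perturbations of size
  \<open>\<eta>\<close>, as is needed under the supremum over these perturbations.
\<close>

definition relative_expansion ::
  "'a set \<Rightarrow> ('a \<Rightarrow> real) \<Rightarrow> (('a \<Rightarrow> real) \<Rightarrow> real) \<Rightarrow> ('a \<Rightarrow> real) \<Rightarrow> bool" where
  "relative_expansion I \<Omega> f E \<longleftrightarrow> (\<forall>e>0. \<forall>\<^sub>F \<eta> in at_right 0. \<forall>\<epsilon> \<Omega>'.
     relatively_perturbed I \<Omega> \<eta> \<epsilon> \<Omega>' \<longrightarrow> \<bar>f \<Omega>' - f \<Omega> - (\<Sum>k\<in>I. \<epsilon> k * E k)\<bar> \<le> e * \<eta>)"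

lemma relative_expansion_const: "relative_expansion I \<Omega> (\<lambda>_. c) (\<lambda>_. 0)"
  unfolding relative_expansion_def
  by (auto intro!: eventually_mono[OF eventually_at_right_less])

lemma relative_expansion_param:
  assumes I: "finite I" "k \<in> I" and h: "(h has_real_derivative h') (at (\<Omega> k))"
  shows "relative_expansion I \<Omega> (\<lambda>\<Omega>. h (\<Omega> k)) (\<lambda>j. if j = k then \<Omega> k * h' else 0)"
  unfolding relative_expansion_def
proof (intro allI impI)
  fix e :: real assume e: "e > 0"
  define w where "w = 1 + \<bar>\<Omega> k\<bar>"
  have w: "w > 0" "\<bar>\<Omega> k\<bar> \<le> w" unfolding w_def by auto
  have "(\<lambda>t. (h (\<Omega> k + t) - h (\<Omega> k)) / t) \<midarrow>0\<rightarrow> h'" using h by (rule DERIV_D)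
  from LIM_D[OF this, of "e / w"] obtain d where d: "d > 0"
    and quot: "\<And>t. t \<noteq> 0 \<Longrightarrow> \<bar>t\<bar> < d \<Longrightarrow> \<bar>(h (\<Omega> k + t) - h (\<Omega> k)) / t - h'\<bar> < e / w"
    using e w by auto
  have hd: "\<bar>h y - h (\<Omega> k) - h' * (y - \<Omega> k)\<bar> \<le> e / w * \<bar>y - \<Omega> k\<bar>" if "\<bar>y - \<Omega> k\<bar> < d" for y
  proof (cases "y = \<Omega> k")
    case False
    define t where "t = y - \<Omega> k"
    have t: "t \<noteq> 0" "\<bar>t\<bar> < d" "y = \<Omega> k + t" using False that by (auto simp: t_def)
    have "h y - h (\<Omega> k) - h' * t = ((h (\<Omega> k + t) - h (\<Omega> k)) / t - h') * t"
      using t by (simp add: field_simps)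
    then have "\<bar>h y - h (\<Omega> k) - h' * t\<bar> = \<bar>(h (\<Omega> k + t) - h (\<Omega> k)) / t - h'\<bar> * \<bar>t\<bar>"
      by (simp add: abs_mult)
    also have "\<dots> \<le> e / w * \<bar>t\<bar>" using quot[OF t(1,2)] by (intro mult_right_mono) auto
    finally show ?thesis unfolding t_def .
  qed simp
  have "\<forall>\<^sub>F \<eta> in at_right 0. (\<eta>::real) \<in> {0<..<d / w}"
    using d w by (intro eventually_at_right_real) auto
  then show "\<forall>\<^sub>F \<eta> in at_right 0. \<forall>\<epsilon> \<Omega>'. relatively_perturbed I \<Omega> \<eta> \<epsilon> \<Omega>' \<longrightarrow>
      \<bar>h (\<Omega>' k) - h (\<Omega> k) - (\<Sum>j\<in>I. \<epsilon> j * (if j = k then \<Omega> k * h' else 0))\<bar> \<le> e * \<eta>"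
  proof (rule eventually_mono, intro allI impI)
    fix \<eta> \<epsilon> \<Omega>' assume \<eta>: "\<eta> \<in> {0<..<d / w}" and "relatively_perturbed I \<Omega> \<eta> \<epsilon> \<Omega>'"
    then have \<epsilon>: "\<bar>\<epsilon> k\<bar> \<le> \<eta>" "\<Omega>' k - \<Omega> k = \<Omega> k * \<epsilon> k"
      using I by (auto simp: relatively_perturbed_def algebra_simps)
    have small: "\<bar>\<Omega>' k - \<Omega> k\<bar> \<le> w * \<eta>"
      unfolding \<epsilon> abs_mult using \<epsilon>(1) w by (intro mult_mono) auto
    also have "w * \<eta> < d" using \<eta> w by (auto simp: field_simps)
    finally have "\<bar>h (\<Omega>' k) - h (\<Omega> k) - h' * (\<Omega>' k - \<Omega> k)\<bar> \<le> e / w * \<bar>\<Omega>' k - \<Omega> k\<bar>"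
      by (rule hd)
    also have "\<dots> \<le> e / w * (w * \<eta>)" using small e w by (intro mult_left_mono) auto
    also have "\<dots> = e * \<eta>" using w by simp
    also have "h' * (\<Omega>' k - \<Omega> k) = (\<Sum>j\<in>I. \<epsilon> j * (if j = k then \<Omega> k * h' else 0))"
      using I by (simp add: \<epsilon> if_distrib sum.delta mult_ac cong: if_cong)
    finally show "\<bar>h (\<Omega>' k) - h (\<Omega> k) - (\<Sum>j\<in>I. \<epsilon> j * (if j = k then \<Omega> k * h' else 0))\<bar> \<le> e * \<eta>" .
  qed
qed

lemma abs_weighted_sum_le:
  fixes \<epsilon> E :: "'a \<Rightarrow> real"
  assumes "\<And>k. k \<in> I \<Longrightarrow> \<bar>\<epsilon> k\<bar> \<le> \<eta>"
  shows "\<bar>\<Sum>k\<in>I. \<epsilon> k * E k\<bar> \<le> \<eta> * (\<Sum>k\<in>I. \<bar>E k\<bar>)"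
proof -
  have "\<bar>\<Sum>k\<in>I. \<epsilon> k * E k\<bar> \<le> (\<Sum>k\<in>I. \<bar>\<epsilon> k * E k\<bar>)" by (rule sum_abs)
  also have "\<dots> \<le> (\<Sum>k\<in>I. \<eta> * \<bar>E k\<bar>)"
    unfolding abs_mult using assms by (intro sum_mono mult_right_mono) auto
  finally show ?thesis by (simp add: sum_distrib_left)
qed

lemma relative_expansion_lipschitz:
  assumes "relative_expansion I \<Omega> f E"
  shows "\<forall>\<^sub>F \<eta> in at_right 0. \<forall>\<epsilon> \<Omega>'. relatively_perturbed I \<Omega> \<eta> \<epsilon> \<Omega>' \<longrightarrow>
    \<bar>f \<Omega>' - f \<Omega>\<bar> \<le> (1 + (\<Sum>k\<in>I. \<bar>E k\<bar>)) * \<eta>"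
proof -
  have "\<forall>\<^sub>F \<eta> in at_right 0. \<forall>\<epsilon> \<Omega>'.
     relatively_perturbed I \<Omega> \<eta> \<epsilon> \<Omega>' \<longrightarrow> \<bar>f \<Omega>' - f \<Omega> - (\<Sum>k\<in>I. \<epsilon> k * E k)\<bar> \<le> 1 * \<eta>"
    using assms unfolding relative_expansion_def by (rule allE[of _ 1]) simp
  then show ?thesis
  proof (rule eventually_mono, intro allI impI)
    fix \<eta> \<epsilon> \<Omega>'
    assume *: "\<forall>\<epsilon> \<Omega>'. relatively_perturbed I \<Omega> \<eta> \<epsilon> \<Omega>' \<longrightarrow> \<bar>f \<Omega>' - f \<Omega> - (\<Sum>k\<in>I. \<epsilon> k * E k)\<bar> \<le> 1 * \<eta>"
      and p: "relatively_perturbed I \<Omega> \<eta> \<epsilon> \<Omega>'"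
    have "\<bar>\<Sum>k\<in>I. \<epsilon> k * E k\<bar> \<le> \<eta> * (\<Sum>k\<in>I. \<bar>E k\<bar>)"
      using p by (intro abs_weighted_sum_le) (auto simp: relatively_perturbed_def)
    moreover have "\<bar>f \<Omega>' - f \<Omega> - (\<Sum>k\<in>I. \<epsilon> k * E k)\<bar> \<le> \<eta>" using * p by auto
    ultimately show "\<bar>f \<Omega>' - f \<Omega>\<bar> \<le> (1 + (\<Sum>k\<in>I. \<bar>E k\<bar>)) * \<eta>"
      by (simp add: algebra_simps)
  qed
qed

lemma relative_expansion_add:
  assumes "relative_expansion I \<Omega> f E" "relative_expansion I \<Omega> g D"
  shows "relative_expansion I \<Omega> (\<lambda>\<Omega>. f \<Omega> + g \<Omega>) (\<lambda>k. E k + D k)"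
  unfolding relative_expansion_def
proof (intro allI impI)
  fix e :: real assume "e > 0"
  then have e: "e / 2 > 0" by simp
  show "\<forall>\<^sub>F \<eta> in at_right 0. \<forall>\<epsilon> \<Omega>'. relatively_perturbed I \<Omega> \<eta> \<epsilon> \<Omega>' \<longrightarrow>
      \<bar>f \<Omega>' + g \<Omega>' - (f \<Omega> + g \<Omega>) - (\<Sum>k\<in>I. \<epsilon> k * (E k + D k))\<bar> \<le> e * \<eta>"
    using assms[unfolded relative_expansion_def, rule_format, OF e]
  proof eventually_elim
    case (elim \<eta>)
    show ?case
    proof (intro allI impI)
      fix \<epsilon> \<Omega>' assume "relatively_perturbed I \<Omega> \<eta> \<epsilon> \<Omega>'"
      then have "\<bar>f \<Omega>' - f \<Omega> - (\<Sum>k\<in>I. \<epsilon> k * E k)\<bar> \<le> e / 2 * \<eta>"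
        "\<bar>g \<Omega>' - g \<Omega> - (\<Sum>k\<in>I. \<epsilon> k * D k)\<bar> \<le> e / 2 * \<eta>" using elim by auto
      then show "\<bar>f \<Omega>' + g \<Omega>' - (f \<Omega> + g \<Omega>) - (\<Sum>k\<in>I. \<epsilon> k * (E k + D k))\<bar> \<le> e * \<eta>"
        unfolding distrib_left sum.distrib by linarith
    qed
  qed
qed

lemma relative_expansion_mult:
  assumes f: "relative_expansion I \<Omega> f E" and g: "relative_expansion I \<Omega> g D"
  shows "relative_expansion I \<Omega> (\<lambda>\<Omega>. f \<Omega> * g \<Omega>) (\<lambda>k. f \<Omega> * D k + g \<Omega> * E k)"
  unfolding relative_expansion_def
proof (intro allI impI)
  fix e :: real assume e: "e > 0"
  define w where "w = 1 + \<bar>f \<Omega>\<bar> + \<bar>g \<Omega>\<bar>"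
  define e' where "e' = e / (2 * w)"
  have w: "w > 0" unfolding w_def by simp
  have e': "e' > 0" "w * e' = e / 2" using e w by (auto simp: e'_def)
  define C D' where "C = 1 + (\<Sum>k\<in>I. \<bar>E k\<bar>)" and "D' = 1 + (\<Sum>k\<in>I. \<bar>D k\<bar>)"
  have CD: "C > 0" "D' > 0" unfolding C_def D'_def by (auto intro!: add_pos_nonneg sum_nonneg)
  have "\<forall>\<^sub>F \<eta> in at_right 0. (\<eta>::real) \<in> {0<..<e / (2 * (C * D'))}"
    using e CD by (intro eventually_at_right_real) auto
  with relative_expansion_lipschitz[OF f, folded C_def] relative_expansion_lipschitz[OF g, folded D'_def]
    f[unfolded relative_expansion_def, rule_format, OF e'(1)]
    g[unfolded relative_expansion_def, rule_format, OF e'(1)]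
  show "\<forall>\<^sub>F \<eta> in at_right 0. \<forall>\<epsilon> \<Omega>'. relatively_perturbed I \<Omega> \<eta> \<epsilon> \<Omega>' \<longrightarrow>
      \<bar>f \<Omega>' * g \<Omega>' - f \<Omega> * g \<Omega> - (\<Sum>k\<in>I. \<epsilon> k * (f \<Omega> * D k + g \<Omega> * E k))\<bar> \<le> e * \<eta>"
  proof eventually_elim
    case (elim \<eta>)
    show ?case
    proof (intro allI impI)
      fix \<epsilon> \<Omega>' assume p: "relatively_perturbed I \<Omega> \<eta> \<epsilon> \<Omega>'"
      define u v where "u = f \<Omega>' - f \<Omega> - (\<Sum>k\<in>I. \<epsilon> k * E k)"
        and "v = g \<Omega>' - g \<Omega> - (\<Sum>k\<in>I. \<epsilon> k * D k)"
      have u: "\<bar>u\<bar> \<le> e' * \<eta>" and v: "\<bar>v\<bar> \<le> e' * \<eta>"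
        and df: "\<bar>f \<Omega>' - f \<Omega>\<bar> \<le> C * \<eta>" and dg: "\<bar>g \<Omega>' - g \<Omega>\<bar> \<le> D' * \<eta>"
        using elim p by (auto simp: u_def v_def)
      have \<eta>: "\<eta> > 0" "(C * D') * \<eta> \<le> e / 2"
        using elim(5) CD by (auto simp: field_simps)
      have eq: "f \<Omega>' * g \<Omega>' - f \<Omega> * g \<Omega> - (\<Sum>k\<in>I. \<epsilon> k * (f \<Omega> * D k + g \<Omega> * E k))
          = f \<Omega> * v + g \<Omega> * u + (f \<Omega>' - f \<Omega>) * (g \<Omega>' - g \<Omega>)"
        by (simp add: u_def v_def algebra_simps sum.distrib sum_distrib_left)
      have "\<bar>f \<Omega> * v + g \<Omega> * u + (f \<Omega>' - f \<Omega>) * (g \<Omega>' - g \<Omega>)\<bar>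
          \<le> \<bar>f \<Omega>\<bar> * \<bar>v\<bar> + \<bar>g \<Omega>\<bar> * \<bar>u\<bar> + \<bar>f \<Omega>' - f \<Omega>\<bar> * \<bar>g \<Omega>' - g \<Omega>\<bar>"
        unfolding abs_mult[symmetric] by linarith
      also have "\<dots> \<le> \<bar>f \<Omega>\<bar> * (e' * \<eta>) + \<bar>g \<Omega>\<bar> * (e' * \<eta>) + (C * \<eta>) * (D' * \<eta>)"
        using u v df dg \<eta> CD by (intro add_mono mult_left_mono mult_mono) auto
      also have "\<dots> \<le> w * (e' * \<eta>) + (C * D' * \<eta>) * \<eta>"
        using e' \<eta> by (simp add: w_def algebra_simps)
      also have "\<dots> \<le> e / 2 * \<eta> + e / 2 * \<eta>"
        using e' \<eta> by (intro add_mono mult_right_mono) (auto simp: mult.assoc[symmetric])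
      finally show "\<bar>f \<Omega>' * g \<Omega>' - f \<Omega> * g \<Omega> - (\<Sum>k\<in>I. \<epsilon> k * (f \<Omega> * D k + g \<Omega> * E k))\<bar> \<le> e * \<eta>"
        unfolding eq by (simp add: mult.commute)
    qed
  qed
qed

text \<open>
  The matrix entries are monomials in functions of single parameters. For these the logarithmic
  gradient \<open>e\<close> is the convenient one: it is additive over factors, and with \<open>f \<Omega> * e k\<close> in place
  of a quotient it makes sense for vanishing factors, too.
\<close>

abbreviation logarithmic_expansion ::
  "'a set \<Rightarrow> ('a \<Rightarrow> real) \<Rightarrow> (('a \<Rightarrow> real) \<Rightarrow> real) \<Rightarrow> ('a \<Rightarrow> real) \<Rightarrow> bool" where
  "logarithmic_expansion I \<Omega> f e \<equiv> relative_expansion I \<Omega> f (\<lambda>k. f \<Omega> * e k)"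

lemma logarithmic_expansion_mult:
  assumes "logarithmic_expansion I \<Omega> f e" "logarithmic_expansion I \<Omega> g d"
  shows "logarithmic_expansion I \<Omega> (\<lambda>\<Omega>. f \<Omega> * g \<Omega>) (\<lambda>k. e k + d k)"
  using relative_expansion_mult[OF assms] by (simp add: algebra_simps)

lemma logarithmic_expansion_prod:
  assumes "\<And>j. j \<in> K \<Longrightarrow> logarithmic_expansion I \<Omega> (f j) (e j)"
  shows "logarithmic_expansion I \<Omega> (\<lambda>\<Omega>. \<Prod>j\<in>K. f j \<Omega>) (\<lambda>k. \<Sum>j\<in>K. e j k)"
  using assms
proof (induction K rule: infinite_finite_induct)
  case (insert j K)
  then have "logarithmic_expansion I \<Omega> (\<lambda>\<Omega>. f j \<Omega> * (\<Prod>j\<in>K. f j \<Omega>)) (\<lambda>k. e j k + (\<Sum>j\<in>K. e j k))"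
    by (intro logarithmic_expansion_mult) auto
  with insert show ?case by simp
qed (simp_all add: relative_expansion_const)

lemma relative_expansion_prod:
  assumes "\<And>j. j \<in> K \<Longrightarrow> \<exists>E. relative_expansion I \<Omega> (f j) E"
  shows "\<exists>E. relative_expansion I \<Omega> (\<lambda>\<Omega>. \<Prod>j\<in>K. f j \<Omega>) E"
  using assms
proof (induction K rule: infinite_finite_induct)
  case (insert j K)
  then obtain E D where "relative_expansion I \<Omega> (f j) E"
    "relative_expansion I \<Omega> (\<lambda>\<Omega>. \<Prod>j\<in>K. f j \<Omega>) D" by blast
  from relative_expansion_mult[OF this] insert show ?case by auto
qed (auto intro: relative_expansion_const)

lemma relative_expansion_sum:
  assumes "\<And>j. j \<in> K \<Longrightarrow> \<exists>E. relative_expansion I \<Omega> (f j) E"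
  shows "\<exists>E. relative_expansion I \<Omega> (\<lambda>\<Omega>. \<Sum>j\<in>K. f j \<Omega>) E"
  using assms
proof (induction K rule: infinite_finite_induct)
  case (insert j K)
  then obtain E D where "relative_expansion I \<Omega> (f j) E"
    "relative_expansion I \<Omega> (\<lambda>\<Omega>. \<Sum>j\<in>K. f j \<Omega>) D" by blast
  from relative_expansion_add[OF this] insert show ?case by auto
qed (auto intro: relative_expansion_const)

text \<open>
  Used only to see that the perturbed coefficient matrices stay nonsingular, so the gradient is
  left unspecified.
\<close>

lemma relative_expansion_det:
  assumes F: "\<And>\<Omega>. F \<Omega> \<in> carrier_mat n n"
    and ex: "\<And>i j. i < n \<Longrightarrow> j < n \<Longrightarrow> relative_expansion I \<Omega> (\<lambda>\<Omega>. F \<Omega> $$ (i, j)) (\<lambda>k. D k i j)"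
  shows "\<exists>E. relative_expansion I \<Omega> (\<lambda>\<Omega>. det (F \<Omega>)) E"
proof -
  have "\<exists>E. relative_expansion I \<Omega>
      (\<lambda>\<Omega>. \<Sum>p\<in>{p. p permutes {0..<n}}. signof p * (\<Prod>i = 0..<n. F \<Omega> $$ (i, p i))) E"
  proof (intro relative_expansion_sum)
    fix p assume p: "p \<in> {p. p permutes {0..<n}}"
    have "\<exists>E. relative_expansion I \<Omega> (\<lambda>\<Omega>. \<Prod>i = 0..<n. F \<Omega> $$ (i, p i)) E"
    proof (intro relative_expansion_prod)
      fix i assume "i \<in> {0..<n}"
      with p have "i < n" "p i < n" by (auto simp: permutes_in_image[of p "{0..<n}"])
      then show "\<exists>E. relative_expansion I \<Omega> (\<lambda>\<Omega>. F \<Omega> $$ (i, p i)) E" using ex by blast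
    qed
    then show "\<exists>E. relative_expansion I \<Omega> (\<lambda>\<Omega>. signof p * (\<Prod>i = 0..<n. F \<Omega> $$ (i, p i))) E"
      using relative_expansion_mult[OF relative_expansion_const] by blast
  qed
  then show ?thesis by (simp add: det_def'[OF F])
qed

lemma eventually_nonzero_of_relative_expansion:
  assumes "relative_expansion I \<Omega> f E" "f \<Omega> \<noteq> 0"
  shows "\<forall>\<^sub>F \<eta> in at_right 0. \<forall>\<epsilon> \<Omega>'. relatively_perturbed I \<Omega> \<eta> \<epsilon> \<Omega>' \<longrightarrow> f \<Omega>' \<noteq> 0"
proof -
  define C where "C = 1 + (\<Sum>k\<in>I. \<bar>E k\<bar>)"
  have C: "C > 0" unfolding C_def by (auto intro!: add_pos_nonneg sum_nonneg)
  have "\<forall>\<^sub>F \<eta> in at_right 0. (\<eta>::real) \<in> {0<..<\<bar>f \<Omega>\<bar> / C}"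
    using C assms by (intro eventually_at_right_real) auto
  with relative_expansion_lipschitz[OF assms(1), folded C_def] show ?thesis
  proof eventually_elim
    case (elim \<eta>)
    then have "C * \<eta> < \<bar>f \<Omega>\<bar>" using C by (auto simp: field_simps)
    with elim show ?case by force
  qed
qed

section \<open>The condition number of a parametrized linear system\<close>

lemma elements_mat_eq: "Z \<in> carrier_mat n m \<Longrightarrow> elements_mat Z = (\<lambda>(i, j). Z $$ (i, j)) ` ({..<n} \<times> {..<m})"
  by (auto simp: elements_mat_def)

lemma abs_entry_le_max_norm:
  assumes "Z \<in> carrier_mat n m" "i < n" "j < m" shows "\<bar>Z $$ (i, j)\<bar> \<le> max_norm Z"
  unfolding max_norm_def elements_mat_eq[OF assms(1)]
  using assms by (intro Max_ge) auto

lemma max_norm_le: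
  assumes "Z \<in> carrier_mat n m" "0 < n" "0 < m" "\<And>i j. i < n \<Longrightarrow> j < m \<Longrightarrow> \<bar>Z $$ (i, j)\<bar> \<le> c"
  shows "max_norm Z \<le> c"
  unfolding max_norm_def elements_mat_eq[OF assms(1)]
  using assms by (subst Max_le_iff) auto

text \<open>
  Entry \<open>(i, j)\<close> of the product \<open>P Z X\<close>: with \<open>P\<close> the inverse of the coefficient matrix, the
  change of the solution is minus this value to first order if the coefficient matrix changes by \<open>Z\<close>.
\<close>

definition response :: "nat \<Rightarrow> real mat \<Rightarrow> real mat \<Rightarrow> nat \<Rightarrow> nat \<Rightarrow> (nat \<Rightarrow> nat \<Rightarrow> real) \<Rightarrow> real" where
  "response n P X i j Z = (\<Sum>l<n. P $$ (i, l) * (\<Sum>r<n. Z l r * X $$ (r, j)))"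

text \<open>
  A nonsingular system whose coefficient matrix and right-hand side are differentiable functions of
  two separate parameter vectors, with relative gradients \<open>DF\<close> and \<open>DR\<close>.
\<close>

locale perturbed_system =
  fixes n m :: nat and I :: "'a set" and F :: "('a \<Rightarrow> real) \<Rightarrow> real mat" and \<Omega> :: "'a \<Rightarrow> real"
    and J :: "'b set" and R :: "('b \<Rightarrow> real) \<Rightarrow> real mat" and \<Psi> :: "'b \<Rightarrow> real"
    and X P :: "real mat" and DF :: "'a \<Rightarrow> nat \<Rightarrow> nat \<Rightarrow> real" and DR :: "'b \<Rightarrow> nat \<Rightarrow> nat \<Rightarrow> real"
  assumes n: "0 < n" and m: "0 < m"
    and F: "\<And>\<Omega>. F \<Omega> \<in> carrier_mat n n" and R: "\<And>\<Psi>. R \<Psi> \<in> carrier_mat n m"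
    and X: "X \<in> carrier_mat n m" and X_pos: "max_norm X > 0"
    and P: "P \<in> carrier_mat n n" and inverse: "P * F \<Omega> = 1\<^sub>m n" and system: "F \<Omega> * X = R \<Psi>"
    and DF: "\<And>i j. i < n \<Longrightarrow> j < n \<Longrightarrow> relative_expansion I \<Omega> (\<lambda>\<Omega>. F \<Omega> $$ (i, j)) (\<lambda>k. DF k i j)"
    and DR: "\<And>i j. i < n \<Longrightarrow> j < m \<Longrightarrow> relative_expansion J \<Psi> (\<lambda>\<Psi>. R \<Psi> $$ (i, j)) (\<lambda>k. DR k i j)"
begin

definition rhs_response :: "nat \<Rightarrow> nat \<Rightarrow> 'b \<Rightarrow> real" where
  "rhs_response i j k = (\<Sum>l<n. P $$ (i, l) * DR k l j)"

definition sensitivity :: "nat \<Rightarrow> nat \<Rightarrow> real" where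
  "sensitivity i j = (\<Sum>k\<in>I. \<bar>response n P X i j (DF k)\<bar>) + (\<Sum>k\<in>J. \<bar>rhs_response i j k\<bar>)"

definition first_order :: "('a \<Rightarrow> real) \<Rightarrow> ('b \<Rightarrow> real) \<Rightarrow> nat \<Rightarrow> nat \<Rightarrow> real" where
  "first_order \<epsilon> \<epsilon>' i j =
     (\<Sum>k\<in>J. \<epsilon>' k * rhs_response i j k) - (\<Sum>k\<in>I. \<epsilon> k * response n P X i j (DF k))"

definition max_sensitivity :: real where
  "max_sensitivity = Max ((\<lambda>(i, j). sensitivity i j) ` ({..<n} \<times> {..<m}))"

lemma sensitivity_le_max: "i < n \<Longrightarrow> j < m \<Longrightarrow> sensitivity i j \<le> max_sensitivity"
  unfolding max_sensitivity_def by (intro Max_ge) auto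

lemma max_sensitivity_attained:
  obtains i j where "i < n" "j < m" "max_sensitivity = sensitivity i j"
proof -
  have "max_sensitivity \<in> (\<lambda>(i, j). sensitivity i j) ` ({..<n} \<times> {..<m})"
    unfolding max_sensitivity_def using n m by (intro Max_in) auto
  then show ?thesis using that by auto
qed

lemma abs_first_order_le:
  assumes "relatively_perturbed I \<Omega> \<eta> \<epsilon> \<Omega>'" "relatively_perturbed J \<Psi> \<eta> \<epsilon>' \<Psi>'"
  shows "\<bar>first_order \<epsilon> \<epsilon>' i j\<bar> \<le> \<eta> * sensitivity i j"
proof -
  have "\<bar>\<Sum>k\<in>J. \<epsilon>' k * rhs_response i j k\<bar> \<le> \<eta> * (\<Sum>k\<in>J. \<bar>rhs_response i j k\<bar>)"
    using assms(2) by (intro abs_weighted_sum_le) (auto simp: relatively_perturbed_def)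
  moreover have "\<bar>\<Sum>k\<in>I. \<epsilon> k * response n P X i j (DF k)\<bar> \<le> \<eta> * (\<Sum>k\<in>I. \<bar>response n P X i j (DF k)\<bar>)"
    using assms(1) by (intro abs_weighted_sum_le) (auto simp: relatively_perturbed_def)
  ultimately show ?thesis unfolding first_order_def sensitivity_def distrib_left by linarith
qed

lemma mult_entry:
  "Z \<in> carrier_mat n n \<Longrightarrow> Y \<in> carrier_mat n m \<Longrightarrow> i < n \<Longrightarrow> j < m \<Longrightarrow>
    (Z * Y) $$ (i, j) = (\<Sum>r<n. Z $$ (i, r) * Y $$ (r, j))"
  by (simp add: scalar_prod_def lessThan_atLeast0)

text \<open>
  Subtracting the two systems and multiplying by the inverse expresses the change \<open>Y\<close> of the
  solution by itself. The last sum contains \<open>Y\<close> with a small factor and is of second order.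
\<close>

lemma solution_change:
  assumes Y: "Y \<in> carrier_mat n m" and eq: "F \<Omega>' * (X + Y) = R \<Psi>'" and ij: "i < n" "j < m"
  shows "Y $$ (i, j) = (\<Sum>l<n. P $$ (i, l) *
    ((R \<Psi>' $$ (l, j) - R \<Psi> $$ (l, j)) - (\<Sum>r<n. (F \<Omega>' $$ (l, r) - F \<Omega> $$ (l, r)) * X $$ (r, j))
      - (\<Sum>r<n. (F \<Omega>' $$ (l, r) - F \<Omega> $$ (l, r)) * Y $$ (r, j))))"
proof -
  have XY: "X + Y \<in> carrier_mat n m" using X Y by simp
  have FY: "F \<Omega> * Y \<in> carrier_mat n m" using F[of \<Omega>] Y by simp
  have "Y = (P * F \<Omega>) * Y" unfolding inverse using Y by simp
  also have "\<dots> = P * (F \<Omega> * Y)" using P F[of \<Omega>] Y by (rule assoc_mult_mat)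
  finally have "Y $$ (i, j) = (P * (F \<Omega> * Y)) $$ (i, j)" by simp
  also have "\<dots> = (\<Sum>l<n. P $$ (i, l) * (F \<Omega> * Y) $$ (l, j))"
    using ij by (intro mult_entry P FY)
  also have "\<dots> = (\<Sum>l<n. P $$ (i, l) *
    ((R \<Psi>' $$ (l, j) - R \<Psi> $$ (l, j)) - (\<Sum>r<n. (F \<Omega>' $$ (l, r) - F \<Omega> $$ (l, r)) * X $$ (r, j))
      - (\<Sum>r<n. (F \<Omega>' $$ (l, r) - F \<Omega> $$ (l, r)) * Y $$ (r, j))))"
  proof (intro sum.cong refl arg_cong2[where f = "(*)"])
    fix l assume l: "l \<in> {..<n}"
    have "R \<Psi>' $$ (l, j) = (\<Sum>r<n. F \<Omega>' $$ (l, r) * (X + Y) $$ (r, j))"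
      unfolding eq[symmetric] using l ij by (intro mult_entry F XY) auto
    also have "\<dots> = (\<Sum>r<n. F \<Omega>' $$ (l, r) * X $$ (r, j)) + (\<Sum>r<n. F \<Omega>' $$ (l, r) * Y $$ (r, j))"
      using X Y ij unfolding sum.distrib[symmetric] by (intro sum.cong) (auto simp: distrib_left)
    moreover have "R \<Psi> $$ (l, j) = (\<Sum>r<n. F \<Omega> $$ (l, r) * X $$ (r, j))"
      unfolding system[symmetric] using l ij by (intro mult_entry F X) auto
    moreover have "(F \<Omega> * Y) $$ (l, j) = (\<Sum>r<n. F \<Omega> $$ (l, r) * Y $$ (r, j))"
      using l ij by (intro mult_entry F Y) auto
    ultimately show "(F \<Omega> * Y) $$ (l, j) = (R \<Psi>' $$ (l, j) - R \<Psi> $$ (l, j))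
        - (\<Sum>r<n. (F \<Omega>' $$ (l, r) - F \<Omega> $$ (l, r)) * X $$ (r, j))
        - (\<Sum>r<n. (F \<Omega>' $$ (l, r) - F \<Omega> $$ (l, r)) * Y $$ (r, j))"
      by (simp add: left_diff_distrib sum_subtractf)
  qed
  finally show ?thesis .
qed

lemma first_order_eq:
  "first_order \<epsilon> \<epsilon>' i j = (\<Sum>l<n. P $$ (i, l) *
    ((\<Sum>k\<in>J. \<epsilon>' k * DR k l j) - (\<Sum>r<n. (\<Sum>k\<in>I. \<epsilon> k * DF k l r) * X $$ (r, j))))"
proof -
  have "(\<Sum>k\<in>J. \<epsilon>' k * rhs_response i j k) = (\<Sum>l<n. P $$ (i, l) * (\<Sum>k\<in>J. \<epsilon>' k * DR k l j))"
    unfolding rhs_response_def sum_distrib_left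
    by (subst sum.swap) (simp add: mult_ac)
  moreover have "(\<Sum>k\<in>I. \<epsilon> k * response n P X i j (DF k)) =
      (\<Sum>l<n. P $$ (i, l) * (\<Sum>r<n. (\<Sum>k\<in>I. \<epsilon> k * DF k l r) * X $$ (r, j)))"
  proof -
    have "(\<Sum>k\<in>I. \<epsilon> k * response n P X i j (DF k)) =
        (\<Sum>l<n. \<Sum>k\<in>I. \<Sum>r<n. \<epsilon> k * (P $$ (i, l) * (DF k l r * X $$ (r, j))))"
      unfolding response_def sum_distrib_left by (rule sum.swap)
    also have "\<dots> = (\<Sum>l<n. \<Sum>r<n. \<Sum>k\<in>I. \<epsilon> k * (P $$ (i, l) * (DF k l r * X $$ (r, j))))"
      by (intro sum.cong refl sum.swap)
    finally show ?thesis by (simp add: sum_distrib_left sum_distrib_right mult_ac)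
  qed
  ultimately show ?thesis
    unfolding first_order_def by (simp add: right_diff_distrib sum_subtractf)
qed

lemma abs_inverse_row_le:
  assumes "i < n" "0 \<le> c" "\<And>l. l < n \<Longrightarrow> \<bar>y l\<bar> \<le> c"
  shows "\<bar>\<Sum>l<n. P $$ (i, l) * y l\<bar> \<le> (\<Sum>i<n. \<Sum>l<n. \<bar>P $$ (i, l)\<bar>) * c"
proof -
  have "\<bar>\<Sum>l<n. P $$ (i, l) * y l\<bar> \<le> (\<Sum>l<n. \<bar>P $$ (i, l) * y l\<bar>)" by (rule sum_abs)
  also have "\<dots> \<le> (\<Sum>l<n. \<bar>P $$ (i, l)\<bar> * c)"
    unfolding abs_mult using assms by (intro sum_mono mult_left_mono) auto
  also have "\<dots> = (\<Sum>l<n. \<bar>P $$ (i, l)\<bar>) * c" by (simp add: sum_distrib_right)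
  also have "\<dots> \<le> (\<Sum>i<n. \<Sum>l<n. \<bar>P $$ (i, l)\<bar>) * c"
    using assms(1,2)
    by (intro mult_right_mono member_le_sum[where f = "\<lambda>i. \<Sum>l<n. \<bar>P $$ (i, l)\<bar>"] sum_nonneg) auto
  finally show ?thesis .
qed

text \<open>
  The change of the coefficient matrix is \<open>O(\<eta>)\<close>, so the implicit equation for \<open>Y\<close> first gives
  \<open>\<bar>Y\<bar> \<le> O(\<eta>) + \<bar>Y\<bar> / 2\<close>, hence \<open>Y = O(\<eta>)\<close>. Then the term that contains \<open>Y\<close> is \<open>O(\<eta>\<^sup>2)\<close>, and what
  remains is the linear part and the remainders of the expansions.
\<close>

lemma solution_expansion:
  assumes e: "e > 0"
  shows "\<forall>\<^sub>F \<eta> in at_right 0. \<forall>\<epsilon> \<Omega>' \<epsilon>' \<Psi>' Y.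
    relatively_perturbed I \<Omega> \<eta> \<epsilon> \<Omega>' \<longrightarrow> relatively_perturbed J \<Psi> \<eta> \<epsilon>' \<Psi>' \<longrightarrow>
    Y \<in> carrier_mat n m \<longrightarrow> F \<Omega>' * (X + Y) = R \<Psi>' \<longrightarrow>
    (\<forall>i<n. \<forall>j<m. \<bar>Y $$ (i, j) - first_order \<epsilon> \<epsilon>' i j\<bar> \<le> e * \<eta>)"
proof -
  define p where "p = 1 + (\<Sum>i<n. \<Sum>l<n. \<bar>P $$ (i, l)\<bar>)"
  have p: "p > 0" unfolding p_def by (auto intro!: add_pos_nonneg sum_nonneg)
  define x where "x = max_norm X"
  have x: "x > 0" using X_pos by (simp add: x_def)
  define w where "w = p * (1 + real n * x)"
  have w: "w > 0" using p x unfolding w_def by (intro mult_pos_pos add_pos_nonneg) auto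
  define e' where "e' = e / (2 * w)"
  have e': "e' > 0" "w * e' = e / 2" using e w by (auto simp: e'_def)
  define C where "C = 1 + (\<Sum>l<n. \<Sum>r<n. \<Sum>k\<in>I. \<bar>DF k l r\<bar>)"
  have C: "C > 0" unfolding C_def by (auto intro!: add_pos_nonneg sum_nonneg)
  have C_ge: "1 + (\<Sum>k\<in>I. \<bar>DF k l r\<bar>) \<le> C" if "l < n" "r < n" for l r
  proof -
    have "(\<Sum>k\<in>I. \<bar>DF k l r\<bar>) \<le> (\<Sum>r<n. \<Sum>k\<in>I. \<bar>DF k l r\<bar>)"
      using that by (intro member_le_sum[where f = "\<lambda>r. \<Sum>k\<in>I. \<bar>DF k l r\<bar>"] sum_nonneg) auto
    also have "\<dots> \<le> (\<Sum>l<n. \<Sum>r<n. \<Sum>k\<in>I. \<bar>DF k l r\<bar>)"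
      using that by (intro member_le_sum[where f = "\<lambda>l. \<Sum>r<n. \<Sum>k\<in>I. \<bar>DF k l r\<bar>"] sum_nonneg) auto
    finally show ?thesis by (simp add: C_def)
  qed
  \<comment> \<open>\<open>q * \<eta>\<close> bounds the factor of the norm of \<open>Y\<close> in the implicit equation, and \<open>2 * K * \<eta>\<close> will
     bound that norm.\<close>
  define q where "q = p * real n * C"
  have q: "q > 0" using p n C by (simp add: q_def)
  define K where "K = 1 + \<bar>max_sensitivity\<bar> + e"
  have K: "K > 0" using e by (simp add: K_def)
  have evA: "\<forall>\<^sub>F \<eta> in at_right 0. \<forall>l\<in>{..<n}. \<forall>r\<in>{..<n}. \<forall>\<epsilon> \<Omega>'. relatively_perturbed I \<Omega> \<eta> \<epsilon> \<Omega>' \<longrightarrow>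
      \<bar>F \<Omega>' $$ (l, r) - F \<Omega> $$ (l, r) - (\<Sum>k\<in>I. \<epsilon> k * DF k l r)\<bar> \<le> e' * \<eta>"
    by (intro eventually_ball_finite ballI)
       (use DF[unfolded relative_expansion_def] e' in auto)
  have evL: "\<forall>\<^sub>F \<eta> in at_right 0. \<forall>l\<in>{..<n}. \<forall>r\<in>{..<n}. \<forall>\<epsilon> \<Omega>'. relatively_perturbed I \<Omega> \<eta> \<epsilon> \<Omega>' \<longrightarrow>
      \<bar>F \<Omega>' $$ (l, r) - F \<Omega> $$ (l, r)\<bar> \<le> (1 + (\<Sum>k\<in>I. \<bar>DF k l r\<bar>)) * \<eta>"
    by (intro eventually_ball_finite ballI)
       (use relative_expansion_lipschitz[OF DF] in auto)
  have evB: "\<forall>\<^sub>F \<eta> in at_right 0. \<forall>l\<in>{..<n}. \<forall>j\<in>{..<m}. \<forall>\<epsilon> \<Psi>'. relatively_perturbed J \<Psi> \<eta> \<epsilon> \<Psi>' \<longrightarrow>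
      \<bar>R \<Psi>' $$ (l, j) - R \<Psi> $$ (l, j) - (\<Sum>k\<in>J. \<epsilon> k * DR k l j)\<bar> \<le> e' * \<eta>"
    by (intro eventually_ball_finite ballI)
       (use DR[unfolded relative_expansion_def] e' in auto)
  have ev\<eta>: "\<forall>\<^sub>F \<eta> in at_right 0. (\<eta>::real) \<in> {0<..<min (1 / (2 * q)) (e / (4 * q * K))}"
    using q K e by (intro eventually_at_right_real) auto
  from evA evL evB ev\<eta> show ?thesis
  proof eventually_elim
    case (elim \<eta>)
    show ?case
    proof (intro allI impI)
      fix \<epsilon> \<Omega>' \<epsilon>' \<Psi>' Y i j
      assume p\<Omega>: "relatively_perturbed I \<Omega> \<eta> \<epsilon> \<Omega>'" and p\<Psi>: "relatively_perturbed J \<Psi> \<eta> \<epsilon>' \<Psi>'"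
        and Y: "Y \<in> carrier_mat n m" and eq: "F \<Omega>' * (X + Y) = R \<Psi>'" and ij: "i < n" "j < m"
      define y where "y = max_norm Y"
      have \<eta>: "\<eta> > 0" "\<eta> < 1 / (2 * q)" "\<eta> < e / (4 * q * K)" using elim(4) by auto
      have q\<eta>: "q * \<eta> \<le> 1 / 2" using \<eta>(2) q by (simp add: field_simps)
      have qK\<eta>: "q * \<eta> * (2 * K) \<le> e / 2" using \<eta>(3) q K by (simp add: field_simps)
      have y: "y \<ge> 0" using abs_entry_le_max_norm[OF Y ij] by (simp add: y_def)
      have rem: "\<bar>Y $$ (i, j) - first_order \<epsilon> \<epsilon>' i j\<bar> \<le> e / 2 * \<eta> + q * \<eta> * y"
        if ij: "i < n" "j < m" for i j
      proof -
        define a where "a l r = F \<Omega>' $$ (l, r) - F \<Omega> $$ (l, r) - (\<Sum>k\<in>I. \<epsilon> k * DF k l r)" for l r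
        define b where "b l = R \<Psi>' $$ (l, j) - R \<Psi> $$ (l, j) - (\<Sum>k\<in>J. \<epsilon>' k * DR k l j)" for l
        define z where "z l = b l - (\<Sum>r<n. a l r * X $$ (r, j))
          - (\<Sum>r<n. (F \<Omega>' $$ (l, r) - F \<Omega> $$ (l, r)) * Y $$ (r, j))" for l
        have a: "\<bar>a l r\<bar> \<le> e' * \<eta>" if "l < n" "r < n" for l r
          using elim(1) p\<Omega> that by (auto simp: a_def)
        have b: "\<bar>b l\<bar> \<le> e' * \<eta>" if "l < n" for l
          using elim(3) p\<Psi> that ij by (auto simp: b_def)
        have A: "\<bar>F \<Omega>' $$ (l, r) - F \<Omega> $$ (l, r)\<bar> \<le> C * \<eta>" if "l < n" "r < n" for l r
        proof -
          have "\<bar>F \<Omega>' $$ (l, r) - F \<Omega> $$ (l, r)\<bar> \<le> (1 + (\<Sum>k\<in>I. \<bar>DF k l r\<bar>)) * \<eta>"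
            using elim(2) p\<Omega> that by auto
          also have "\<dots> \<le> C * \<eta>" using C_ge[OF that] \<eta> by (intro mult_right_mono) auto
          finally show ?thesis .
        qed
        have z: "\<bar>z l\<bar> \<le> e' * \<eta> + real n * (e' * \<eta> * x) + real n * (C * \<eta> * y)" if l: "l < n" for l
        proof -
          have "\<bar>\<Sum>r<n. a l r * X $$ (r, j)\<bar> \<le> (\<Sum>r<n. \<bar>a l r * X $$ (r, j)\<bar>)" by (rule sum_abs)
          also have "\<dots> \<le> (\<Sum>r<n. e' * \<eta> * x)"
            unfolding abs_mult x_def using l ij e' \<eta> a abs_entry_le_max_norm[OF X]
            by (intro sum_mono mult_mono) auto
          finally have 1: "\<bar>\<Sum>r<n. a l r * X $$ (r, j)\<bar> \<le> real n * (e' * \<eta> * x)" by simp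
          have "\<bar>\<Sum>r<n. (F \<Omega>' $$ (l, r) - F \<Omega> $$ (l, r)) * Y $$ (r, j)\<bar>
              \<le> (\<Sum>r<n. \<bar>(F \<Omega>' $$ (l, r) - F \<Omega> $$ (l, r)) * Y $$ (r, j)\<bar>)" by (rule sum_abs)
          also have "\<dots> \<le> (\<Sum>r<n. C * \<eta> * y)"
            unfolding abs_mult y_def using l ij C \<eta> A abs_entry_le_max_norm[OF Y]
            by (intro sum_mono mult_mono) auto
          finally have 2: "\<bar>\<Sum>r<n. (F \<Omega>' $$ (l, r) - F \<Omega> $$ (l, r)) * Y $$ (r, j)\<bar> \<le> real n * (C * \<eta> * y)"
            by simp
          from 1 2 b[OF l] show ?thesis unfolding z_def by linarith
        qed
        have "Y $$ (i, j) - first_order \<epsilon> \<epsilon>' i j = (\<Sum>l<n. P $$ (i, l) * z l)"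
          unfolding solution_change[OF Y eq ij] first_order_eq z_def a_def b_def
            sum_subtractf[symmetric] right_diff_distrib[symmetric]
          by (intro sum.cong refl arg_cong2[where f = "(*)"])
             (simp add: left_diff_distrib sum_subtractf)
        also have "\<bar>\<dots>\<bar> \<le> (\<Sum>i<n. \<Sum>l<n. \<bar>P $$ (i, l)\<bar>) * (e' * \<eta> + real n * (e' * \<eta> * x) + real n * (C * \<eta> * y))"
          using ij z C \<eta> e' x y by (intro abs_inverse_row_le) auto
        also have "\<dots> \<le> p * (e' * \<eta> + real n * (e' * \<eta> * x) + real n * (C * \<eta> * y))"
          using C \<eta> e' x y by (intro mult_right_mono) (auto simp: p_def)
        also have "\<dots> = (w * e') * \<eta> + q * \<eta> * y" by (simp add: w_def q_def algebra_simps)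
        finally show ?thesis unfolding e'(2) .
      qed
      have "y \<le> \<eta> * \<bar>max_sensitivity\<bar> + (e / 2 * \<eta> + q * \<eta> * y)"
        unfolding y_def
      proof (rule max_norm_le[OF Y n m], fold y_def)
        fix i j assume ij: "i < n" "j < m"
        have "\<bar>first_order \<epsilon> \<epsilon>' i j\<bar> \<le> \<eta> * \<bar>max_sensitivity\<bar>"
          using abs_first_order_le[OF p\<Omega> p\<Psi>, of i j] sensitivity_le_max[OF ij] \<eta>
          by (smt (verit) mult_left_mono)
        with rem[OF ij] show "\<bar>Y $$ (i, j)\<bar> \<le> \<eta> * \<bar>max_sensitivity\<bar> + (e / 2 * \<eta> + q * \<eta> * y)"
          by linarith
      qed
      moreover have "q * \<eta> * y \<le> 1 / 2 * y" using q\<eta> y by (intro mult_right_mono) auto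
      moreover have "y \<le> 2 * (a + b)" if "y \<le> a + (b + c)" "c \<le> 1 / 2 * y" for a b c :: real
        using that by simp
      ultimately have "y \<le> 2 * (\<eta> * \<bar>max_sensitivity\<bar> + e / 2 * \<eta>)" by blast
      also have "\<dots> \<le> 2 * K * \<eta>" using e \<eta> by (simp add: K_def algebra_simps)
      finally have "q * \<eta> * y \<le> q * \<eta> * (2 * K * \<eta>)"
        using q \<eta> by (intro mult_left_mono) auto
      also have "\<dots> = (q * \<eta> * (2 * K)) * \<eta>" by simp
      also have "\<dots> \<le> e / 2 * \<eta>" using qK\<eta> \<eta> by (intro mult_right_mono) auto
      finally show "\<bar>Y $$ (i, j) - first_order \<epsilon> \<epsilon>' i j\<bar> \<le> e * \<eta>"
        using rem[OF ij] by simp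
    qed
  qed
qed

text \<open>
  The determinant of the coefficient matrix varies continuously with the parameters, so it stays
  nonzero. The lower bound on the condition number needs a solution for the worst perturbation,
  since otherwise this perturbation would contribute no quotient.
\<close>

lemma perturbed_system_solvable:
  "\<forall>\<^sub>F \<eta> in at_right 0. \<forall>\<epsilon> \<Omega>'. relatively_perturbed I \<Omega> \<eta> \<epsilon> \<Omega>' \<longrightarrow>
    (\<forall>\<Psi>'. \<exists>Y\<in>carrier_mat n m. F \<Omega>' * (X + Y) = R \<Psi>')"
proof -
  obtain E where E: "relative_expansion I \<Omega> (\<lambda>\<Omega>. det (F \<Omega>)) E"
    using relative_expansion_det[of F n I \<Omega> DF] F DF by blast
  have "det P * det (F \<Omega>) = det (P * F \<Omega>)" using P F by (simp add: det_mult)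
  then have "det (F \<Omega>) \<noteq> 0" unfolding inverse by auto
  from eventually_nonzero_of_relative_expansion[OF E this] show ?thesis
  proof (rule eventually_mono, intro allI impI)
    fix \<eta> \<epsilon> \<Omega>' \<Psi>'
    assume "\<forall>\<epsilon> \<Omega>'. relatively_perturbed I \<Omega> \<eta> \<epsilon> \<Omega>' \<longrightarrow> det (F \<Omega>') \<noteq> 0"
      and "relatively_perturbed I \<Omega> \<eta> \<epsilon> \<Omega>'"
    then have "det (F \<Omega>') \<noteq> 0" by blast
    then obtain Q where Q: "Q \<in> carrier_mat n n" "F \<Omega>' * Q = 1\<^sub>m n"
      using det_non_zero_imp_unit[OF F, of \<Omega>'] F[of \<Omega>']
      by (auto simp: Units_def ring_mat_def)
    have QR: "Q * R \<Psi>' \<in> carrier_mat n m" using Q R by simp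
    have "X + (Q * R \<Psi>' - X) = Q * R \<Psi>'"
      using carrier_matD[OF QR] carrier_matD[OF X] by (intro eq_matI) (simp_all del: index_mult_mat)
    moreover have "F \<Omega>' * (Q * R \<Psi>') = R \<Psi>'"
      using assoc_mult_mat[OF F Q(1) R, symmetric, of \<Omega>' \<Psi>'] Q(2) R[of \<Psi>'] by simp
    ultimately show "\<exists>Y\<in>carrier_mat n m. F \<Omega>' * (X + Y) = R \<Psi>'"
      using QR X by (intro bexI[of _ "Q * R \<Psi>' - X"]) auto
  qed
qed

lemma cond_quotients_le:
  assumes e: "e > 0"
  shows "\<forall>\<^sub>F \<eta> in at_right 0. \<forall>c\<in>cond_quotients n m I F \<Omega> J R \<Psi> X \<eta>. c \<le> (max_sensitivity + e) / max_norm X"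
proof -
  have "\<forall>\<^sub>F \<eta> in at_right 0. (\<eta>::real) > 0" by (rule eventually_at_right_less)
  with solution_expansion[OF e] show ?thesis
  proof eventually_elim
    case (elim \<eta>)
    show ?case
    proof
      fix c assume "c \<in> cond_quotients n m I F \<Omega> J R \<Psi> X \<eta>"
      then obtain Y \<delta>\<Omega> \<delta>\<Psi> where c: "c = 1 / \<eta> * (max_norm Y / max_norm X)" and Y: "Y \<in> carrier_mat n m"
        and eq: "F (\<lambda>k. \<Omega> k + \<delta>\<Omega> k) * (X + Y) = R (\<lambda>k. \<Psi> k + \<delta>\<Psi> k)"
        and \<delta>: "\<And>k. k \<in> I \<Longrightarrow> \<bar>\<delta>\<Omega> k\<bar> \<le> \<eta> * \<bar>\<Omega> k\<bar>" "\<And>k. k \<in> J \<Longrightarrow> \<bar>\<delta>\<Psi> k\<bar> \<le> \<eta> * \<bar>\<Psi> k\<bar>"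
        unfolding cond_quotients_def by blast
      \<comment> \<open>A vanishing parameter admits only the zero perturbation, and then \<open>d / w = 0\<close> is a valid
         relative perturbation.\<close>
      have rel: "\<bar>d / w\<bar> \<le> \<eta> \<and> w + d = w * (1 + d / w)" if "\<bar>d\<bar> \<le> \<eta> * \<bar>w\<bar>" for d w :: real
        using that elim(2) by (cases "w = 0") (auto simp: field_simps)
      have p: "relatively_perturbed I \<Omega> \<eta> (\<lambda>k. \<delta>\<Omega> k / \<Omega> k) (\<lambda>k. \<Omega> k + \<delta>\<Omega> k)"
        "relatively_perturbed J \<Psi> \<eta> (\<lambda>k. \<delta>\<Psi> k / \<Psi> k) (\<lambda>k. \<Psi> k + \<delta>\<Psi> k)"
        unfolding relatively_perturbed_def using rel \<delta> by blast+
      have "max_norm Y \<le> \<eta> * (max_sensitivity + e)"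
      proof (rule max_norm_le[OF Y n m])
        fix i j assume ij: "i < n" "j < m"
        define L where "L = first_order (\<lambda>k. \<delta>\<Omega> k / \<Omega> k) (\<lambda>k. \<delta>\<Psi> k / \<Psi> k) i j"
        have "\<bar>Y $$ (i, j) - L\<bar> \<le> e * \<eta>"
          using elim(1) p Y eq ij unfolding L_def by blast
        moreover have "\<bar>L\<bar> \<le> \<eta> * sensitivity i j" unfolding L_def by (rule abs_first_order_le[OF p])
        moreover have "\<eta> * sensitivity i j \<le> \<eta> * max_sensitivity"
          using sensitivity_le_max[OF ij] elim(2) by (intro mult_left_mono) auto
        ultimately show "\<bar>Y $$ (i, j)\<bar> \<le> \<eta> * (max_sensitivity + e)"
          by (simp add: algebra_simps)
      qed
      then show "c \<le> (max_sensitivity + e) / max_norm X"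
        unfolding c using elim(2) X_pos by (simp add: field_simps)
    qed
  qed
qed

text \<open>
  At an entry where the sensitivity is largest, the signs of the relative perturbations are chosen
  so that all terms of the linear part add up.
\<close>

lemma cond_quotients_ge:
  assumes e: "e > 0"
  shows "\<forall>\<^sub>F \<eta> in at_right 0. \<exists>c\<in>cond_quotients n m I F \<Omega> J R \<Psi> X \<eta>. (max_sensitivity - e) / max_norm X \<le> c"
proof -
  obtain i j where ij: "i < n" "j < m" "max_sensitivity = sensitivity i j"
    by (rule max_sensitivity_attained)
  have "\<forall>\<^sub>F \<eta> in at_right 0. (\<eta>::real) > 0" by (rule eventually_at_right_less)
  with solution_expansion[OF e] perturbed_system_solvable show ?thesis
  proof eventually_elim
    case (elim \<eta>)
    define \<epsilon> where "\<epsilon> k = - \<eta> * sgn (response n P X i j (DF k))" for k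
    define \<epsilon>' where "\<epsilon>' k = \<eta> * sgn (rhs_response i j k)" for k
    have \<epsilon>: "\<bar>\<epsilon> k\<bar> \<le> \<eta>" "\<bar>\<epsilon>' l\<bar> \<le> \<eta>" for k l
      using elim(3) by (auto simp: \<epsilon>_def \<epsilon>'_def abs_mult abs_sgn_eq)
    have p: "relatively_perturbed I \<Omega> \<eta> \<epsilon> (\<lambda>k. \<Omega> k + \<Omega> k * \<epsilon> k)"
      "relatively_perturbed J \<Psi> \<eta> \<epsilon>' (\<lambda>k. \<Psi> k + \<Psi> k * \<epsilon>' k)"
      unfolding relatively_perturbed_def using \<epsilon> by (auto simp: algebra_simps)
    from elim(2) p(1) obtain Y where Y: "Y \<in> carrier_mat n m"
      and eq: "F (\<lambda>k. \<Omega> k + \<Omega> k * \<epsilon> k) * (X + Y) = R (\<lambda>k. \<Psi> k + \<Psi> k * \<epsilon>' k)" by blast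
    have "first_order \<epsilon> \<epsilon>' i j = \<eta> * sensitivity i j"
      unfolding first_order_def sensitivity_def \<epsilon>_def \<epsilon>'_def
      by (simp add: abs_sgn sum_distrib_left sum_negf distrib_left mult_ac)
    moreover have "\<bar>Y $$ (i, j) - first_order \<epsilon> \<epsilon>' i j\<bar> \<le> e * \<eta>"
      using elim(1) p Y eq ij by blast
    ultimately have "\<eta> * (max_sensitivity - e) \<le> \<bar>Y $$ (i, j)\<bar>"
      unfolding ij(3) by (simp add: algebra_simps)
    also have "\<dots> \<le> max_norm Y" using Y ij by (intro abs_entry_le_max_norm)
    finally have "max_sensitivity - e \<le> max_norm Y / \<eta>"
      using elim(3) by (simp add: pos_le_divide_eq mult.commute)
    then have "(max_sensitivity - e) / max_norm X \<le> max_norm Y / \<eta> / max_norm X"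
      using X_pos by (intro divide_right_mono) auto
    then have "(max_sensitivity - e) / max_norm X \<le> 1 / \<eta> * (max_norm Y / max_norm X)"
      by (simp add: mult.commute)
    moreover have "1 / \<eta> * (max_norm Y / max_norm X) \<in> cond_quotients n m I F \<Omega> J R \<Psi> X \<eta>"
    proof -
      have "\<forall>k\<in>I. \<bar>\<Omega> k * \<epsilon> k\<bar> \<le> \<eta> * \<bar>\<Omega> k\<bar>" "\<forall>k\<in>J. \<bar>\<Psi> k * \<epsilon>' k\<bar> \<le> \<eta> * \<bar>\<Psi> k\<bar>"
        using \<epsilon> by (auto simp: abs_mult mult.commute[of \<eta>] intro!: mult_left_mono)
      with Y eq show ?thesis
        unfolding cond_quotients_def mem_Collect_eq
        by (intro exI[of _ Y] exI[of _ "\<lambda>k. \<Omega> k * \<epsilon> k"] exI[of _ "\<lambda>k. \<Psi> k * \<epsilon>' k"]) simp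
    qed
    ultimately show ?case by blast
  qed
qed

lemma cond_number_eq: "cond_number n m I F \<Omega> J R \<Psi> X = ereal (max_sensitivity / max_norm X)"
  unfolding cond_number_def
proof (rule tendsto_Lim)
  show "((\<lambda>\<eta>. Sup (ereal ` cond_quotients n m I F \<Omega> J R \<Psi> X \<eta>)) \<longlongrightarrow> ereal (max_sensitivity / max_norm X)) (at_right 0)"
  proof (rule order_tendstoI)
    fix a assume "a < ereal (max_sensitivity / max_norm X)"
    then obtain z where z: "a < ereal z" "z < max_sensitivity / max_norm X"
      using ereal_dense2 by (metis less_ereal.simps(1))
    define e where "e = max_sensitivity - z * max_norm X"
    have e: "e > 0" "(max_sensitivity - e) / max_norm X = z"
      using z X_pos by (auto simp: e_def field_simps)
    from cond_quotients_ge[OF e(1)]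
    show "\<forall>\<^sub>F \<eta> in at_right 0. a < Sup (ereal ` cond_quotients n m I F \<Omega> J R \<Psi> X \<eta>)"
    proof eventually_elim
      case (elim \<eta>)
      then obtain c where "c \<in> cond_quotients n m I F \<Omega> J R \<Psi> X \<eta>" "z \<le> c" unfolding e(2) by blast
      then have "ereal z \<le> Sup (ereal ` cond_quotients n m I F \<Omega> J R \<Psi> X \<eta>)"
        by (intro Sup_upper2[of "ereal c"]) auto
      with z(1) show ?case by (rule less_le_trans)
    qed
  next
    fix a assume "ereal (max_sensitivity / max_norm X) < a"
    then obtain z where z: "ereal z < a" "max_sensitivity / max_norm X < z"
      using ereal_dense2 by (metis less_ereal.simps(1))
    define e where "e = z * max_norm X - max_sensitivity"
    have e: "e > 0" "(max_sensitivity + e) / max_norm X = z"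
      using z X_pos by (auto simp: e_def field_simps)
    from cond_quotients_le[OF e(1)]
    show "\<forall>\<^sub>F \<eta> in at_right 0. Sup (ereal ` cond_quotients n m I F \<Omega> J R \<Psi> X \<eta>) < a"
    proof eventually_elim
      case (elim \<eta>)
      then have "Sup (ereal ` cond_quotients n m I F \<Omega> J R \<Psi> X \<eta>) \<le> ereal z"
        unfolding e(2) by (intro Sup_least) auto
      then show ?case using z(1) by (rule le_less_trans)
    qed
  qed
qed simp

end

section \<open>Relative gradients of the two representations\<close>

text \<open>
  The part of \<open>A\<close> selected by a predicate on positions; the predicate counts rows and columns from
  \<open>1\<close>, as the parameters do, whereas the arguments \<open>l\<close> and \<open>r\<close> count from \<open>0\<close>.
\<close>

definition part :: "real mat \<Rightarrow> (nat \<Rightarrow> nat \<Rightarrow> bool) \<Rightarrow> nat \<Rightarrow> nat \<Rightarrow> real" where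
  "part A Q l r = (if Q (Suc l) (Suc r) then A $$ (l, r) else 0)"

text \<open>
  Each quasiseparable parameter occurs to the first power in the entries that contain it. Its
  relative gradient is therefore \<open>A\<close> itself, restricted to these entries, and does not depend on
  the chosen representation.
\<close>

fun qs_gradient :: "real mat \<Rightarrow> qs_name \<Rightarrow> nat \<Rightarrow> nat \<Rightarrow> real" where
  "qs_gradient A (QS_p k) = part A (\<lambda>i j. j < i \<and> i = k)"
| "qs_gradient A (QS_a k) = part A (\<lambda>i j. j < k \<and> k < i)"
| "qs_gradient A (QS_q k) = part A (\<lambda>i j. j < i \<and> j = k)"
| "qs_gradient A (QS_d k) = part A (\<lambda>i j. i = k \<and> j = k)"
| "qs_gradient A (QS_g k) = part A (\<lambda>i j. i < j \<and> i = k)"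
| "qs_gradient A (QS_b k) = part A (\<lambda>i j. i < k \<and> k < j)"
| "qs_gradient A (QS_h k) = part A (\<lambda>i j. i < j \<and> j = k)"

text \<open>
  The tangent \<open>x\<close> occurs as a cosine, with logarithmic derivative \<open>- (tan_sin x)\<^sup>2\<close>, in one row or
  column, and as a sine, with logarithmic derivative \<open>(tan_cos x)\<^sup>2\<close>, in the adjacent block.
\<close>

fun gv_gradient :: "(gv_name \<Rightarrow> real) \<Rightarrow> real mat \<Rightarrow> gv_name \<Rightarrow> nat \<Rightarrow> nat \<Rightarrow> real" where
  "gv_gradient \<Omega> A (GV_l k) = (\<lambda>l r. (tan_cos (\<Omega> (GV_l k)))\<^sup>2 * part A (\<lambda>i j. j < k \<and> k < i) l r
     - (tan_sin (\<Omega> (GV_l k)))\<^sup>2 * part A (\<lambda>i j. j < i \<and> i = k) l r)"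
| "gv_gradient \<Omega> A (GV_v k) = part A (\<lambda>i j. j < i \<and> j = k)"
| "gv_gradient \<Omega> A (GV_d k) = part A (\<lambda>i j. i = k \<and> j = k)"
| "gv_gradient \<Omega> A (GV_w k) = part A (\<lambda>i j. i < j \<and> i = k)"
| "gv_gradient \<Omega> A (GV_u k) = (\<lambda>l r. (tan_cos (\<Omega> (GV_u k)))\<^sup>2 * part A (\<lambda>i j. i < k \<and> k < j) l r
     - (tan_sin (\<Omega> (GV_u k)))\<^sup>2 * part A (\<lambda>i j. i < j \<and> j = k) l r)"

lemma relative_expansion_cong:
  assumes "relative_expansion I \<Omega> f E" "\<And>k. k \<in> I \<Longrightarrow> E k = E' k"
  shows "relative_expansion I \<Omega> f E'"
proof -
  have "(\<Sum>k\<in>I. \<epsilon> k * E k) = (\<Sum>k\<in>I. \<epsilon> k * E' k)" for \<epsilon>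
    using assms(2) by (intro sum.cong) auto
  with assms(1) show ?thesis unfolding relative_expansion_def by simp
qed

lemma logarithmic_expansion_param:
  assumes "finite I" "k \<in> I"
  shows "logarithmic_expansion I \<Omega> (\<lambda>\<Omega>. \<Omega> k) (\<lambda>j. if j = k then 1 else 0)"
  by (rule relative_expansion_cong[OF relative_expansion_param[OF assms, of "\<lambda>x. x" 1]]) auto

lemma tan_cos_sin_squares: "(tan_cos x)\<^sup>2 + (tan_sin x)\<^sup>2 = 1"
proof -
  have "1 + x\<^sup>2 > 0" by (rule add_pos_nonneg) auto
  then show ?thesis
    unfolding tan_cos_def tan_sin_def power_divide by (simp add: add_divide_distrib[symmetric])
qed

lemma DERIV_tan_cos: "(tan_cos has_real_derivative - x * tan_cos x ^ 3) (at x)"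
proof -
  have pos: "1 + x\<^sup>2 > 0" by (rule add_pos_nonneg) auto
  then have sq: "sqrt (1 + x\<^sup>2) \<noteq> 0" by simp
  have "((\<lambda>x. 1 + x\<^sup>2) has_real_derivative 2 * x) (at x)"
    by (auto intro!: derivative_eq_intros)
  from DERIV_inverse'[OF DERIV_chain2[OF DERIV_real_sqrt[OF pos] this] sq]
  have "((\<lambda>x. inverse (sqrt (1 + x\<^sup>2))) has_real_derivative - x * inverse (sqrt (1 + x\<^sup>2)) ^ 3) (at x)"
    by (rule DERIV_cong) (simp add: power3_eq_cube)
  then show ?thesis unfolding tan_cos_def[abs_def] by (simp add: inverse_eq_divide)
qed

lemma logarithmic_expansion_tan_cos:
  assumes "finite I" "k \<in> I"
  shows "logarithmic_expansion I \<Omega> (\<lambda>\<Omega>. tan_cos (\<Omega> k)) (\<lambda>j. if j = k then - (tan_sin (\<Omega> k))\<^sup>2 else 0)"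
  by (rule relative_expansion_cong[OF relative_expansion_param[where h = tan_cos, OF assms DERIV_tan_cos]])
     (auto simp: tan_sin_def tan_cos_def power2_eq_square power3_eq_cube)

text \<open>
  From \<open>tan_sin x = x * tan_cos x\<close>: the logarithmic derivatives add up to
  \<open>1 - (tan_sin x)\<^sup>2\<close>.
\<close>

lemma logarithmic_expansion_tan_sin:
  assumes "finite I" "k \<in> I"
  shows "logarithmic_expansion I \<Omega> (\<lambda>\<Omega>. tan_sin (\<Omega> k)) (\<lambda>j. if j = k then (tan_cos (\<Omega> k))\<^sup>2 else 0)"
proof -
  have *: "tan_sin x = x * tan_cos x" for x by (simp add: tan_sin_def tan_cos_def)
  have "logarithmic_expansion I \<Omega> (\<lambda>\<Omega>. \<Omega> k * tan_cos (\<Omega> k))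
      (\<lambda>j. (if j = k then 1 else 0) + (if j = k then - (tan_sin (\<Omega> k))\<^sup>2 else 0))"
    by (rule logarithmic_expansion_mult[OF logarithmic_expansion_param[OF assms]
          logarithmic_expansion_tan_cos[OF assms]])
  then have "logarithmic_expansion I \<Omega> (\<lambda>\<Omega>. tan_sin (\<Omega> k))
      (\<lambda>j. (if j = k then 1 else 0) + (if j = k then - (tan_sin (\<Omega> k))\<^sup>2 else 0))"
    unfolding * .
  moreover have "1 - (tan_sin (\<Omega> k))\<^sup>2 = (tan_cos (\<Omega> k))\<^sup>2"
    using tan_cos_sin_squares[of "\<Omega> k"] by simp
  ultimately show ?thesis by (elim relative_expansion_cong) simp
qed

lemma finite_qs_names: "finite (qs_names n)" and finite_gv_names: "finite (gv_names n)"
  by (auto simp: qs_names_def gv_names_def)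

lemma qs_expansion:
  assumes l: "l < n" and r: "r < n"
  shows "relative_expansion (qs_names n) \<Omega> (\<lambda>\<Omega>. qs_matrix n \<Omega> $$ (l, r))
    (\<lambda>k. qs_gradient (qs_matrix n \<Omega>) k l r)"
proof -
  note param = logarithmic_expansion_param[OF finite_qs_names]
  define i j where "i = Suc l" and "j = Suc r"
  have entry: "qs_matrix n \<Omega> $$ (l, r) = qs_entry \<Omega> i j" for \<Omega>
    using l r by (simp add: qs_matrix_def i_def j_def)
  have ij: "1 \<le> i" "i \<le> n" "1 \<le> j" "j \<le> n" using l r by (auto simp: i_def j_def)
  have part: "part (qs_matrix n \<Omega>) Q l r = (if Q i j then qs_entry \<Omega> i j else 0)" for Q
    unfolding part_def entry by (simp add: i_def j_def)
  consider "i = j" | "j < i" | "i < j" by linarith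
  then show ?thesis
  proof cases
    case 1
    have "logarithmic_expansion (qs_names n) \<Omega> (\<lambda>\<Omega>. \<Omega> (QS_d i)) (\<lambda>x. if x = QS_d i then 1 else 0)"
      by (rule param) (use ij in \<open>auto simp: qs_names_def\<close>)
    then have "logarithmic_expansion (qs_names n) \<Omega> (\<lambda>\<Omega>. qs_matrix n \<Omega> $$ (l, r)) (\<lambda>x. if x = QS_d i then 1 else 0)"
      unfolding entry qs_entry_def using 1 by simp
    then show ?thesis
    proof (rule relative_expansion_cong)
      fix x assume "x \<in> qs_names n"
      show "qs_matrix n \<Omega> $$ (l, r) * (if x = QS_d i then 1 else 0) = qs_gradient (qs_matrix n \<Omega>) x l r"
        unfolding entry using 1 by (cases x) (auto simp: part)
    qed
  next
    case 2
    have "logarithmic_expansion (qs_names n) \<Omega> (\<lambda>\<Omega>. \<Omega> (QS_p i) * (\<Prod>k\<in>{j<..<i}. \<Omega> (QS_a k)) * \<Omega> (QS_q j))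
        (\<lambda>x. ((if x = QS_p i then 1 else 0) + (\<Sum>k\<in>{j<..<i}. if x = QS_a k then 1 else 0))
          + (if x = QS_q j then 1 else 0))"
      by (intro logarithmic_expansion_mult logarithmic_expansion_prod param)
         (use ij 2 in \<open>auto simp: qs_names_def\<close>)
    then have "logarithmic_expansion (qs_names n) \<Omega> (\<lambda>\<Omega>. qs_matrix n \<Omega> $$ (l, r))
        (\<lambda>x. ((if x = QS_p i then 1 else 0) + (\<Sum>k\<in>{j<..<i}. if x = QS_a k then 1 else 0))
          + (if x = QS_q j then 1 else 0))"
      unfolding entry qs_entry_def using 2 by simp
    then show ?thesis
    proof (rule relative_expansion_cong)
      fix x assume "x \<in> qs_names n"
      show "qs_matrix n \<Omega> $$ (l, r) * (((if x = QS_p i then 1 else 0)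
          + (\<Sum>k\<in>{j<..<i}. if x = QS_a k then 1 else 0)) + (if x = QS_q j then 1 else 0))
          = qs_gradient (qs_matrix n \<Omega>) x l r"
        unfolding entry using 2 by (cases x) (auto simp: part)
    qed
  next
    case 3
    have "logarithmic_expansion (qs_names n) \<Omega> (\<lambda>\<Omega>. \<Omega> (QS_g i) * (\<Prod>k\<in>{i<..<j}. \<Omega> (QS_b k)) * \<Omega> (QS_h j))
        (\<lambda>x. ((if x = QS_g i then 1 else 0) + (\<Sum>k\<in>{i<..<j}. if x = QS_b k then 1 else 0))
          + (if x = QS_h j then 1 else 0))"
      by (intro logarithmic_expansion_mult logarithmic_expansion_prod param)
         (use ij 3 in \<open>auto simp: qs_names_def\<close>)
    then have "logarithmic_expansion (qs_names n) \<Omega> (\<lambda>\<Omega>. qs_matrix n \<Omega> $$ (l, r))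
        (\<lambda>x. ((if x = QS_g i then 1 else 0) + (\<Sum>k\<in>{i<..<j}. if x = QS_b k then 1 else 0))
          + (if x = QS_h j then 1 else 0))"
      unfolding entry qs_entry_def using 3 by simp
    then show ?thesis
    proof (rule relative_expansion_cong)
      fix x assume "x \<in> qs_names n"
      show "qs_matrix n \<Omega> $$ (l, r) * (((if x = QS_g i then 1 else 0)
          + (\<Sum>k\<in>{i<..<j}. if x = QS_b k then 1 else 0)) + (if x = QS_h j then 1 else 0))
          = qs_gradient (qs_matrix n \<Omega>) x l r"
        unfolding entry using 3 by (cases x) (auto simp: part)
    qed
  qed
qed

text \<open>
  The last cosine is the constant \<open>1\<close>, hence the exception for \<open>i = n\<close>.
\<close>

lemma gv_c_expansion:
  assumes "2 \<le> i" "i \<le> n"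
  shows "logarithmic_expansion (gv_names n) \<Omega> (\<lambda>\<Omega>. gv_c n \<Omega> i)
    (\<lambda>x. if x = GV_l i \<and> i \<noteq> n then - (tan_sin (\<Omega> (GV_l i)))\<^sup>2 else 0)"
proof (cases "i = n")
  case False
  with assms have "GV_l i \<in> gv_names n" by (auto simp: gv_names_def)
  with logarithmic_expansion_tan_cos[OF finite_gv_names this, of \<Omega>] False show ?thesis
    by (simp add: gv_c_def)
qed (simp add: gv_c_def relative_expansion_const)

lemma gv_r_expansion:
  assumes "2 \<le> j" "j \<le> n"
  shows "logarithmic_expansion (gv_names n) \<Omega> (\<lambda>\<Omega>. gv_r n \<Omega> j)
    (\<lambda>x. if x = GV_u j \<and> j \<noteq> n then - (tan_sin (\<Omega> (GV_u j)))\<^sup>2 else 0)"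
proof (cases "j = n")
  case False
  with assms have "GV_u j \<in> gv_names n" by (auto simp: gv_names_def)
  with logarithmic_expansion_tan_cos[OF finite_gv_names this, of \<Omega>] False show ?thesis
    by (simp add: gv_r_def)
qed (simp add: gv_r_def relative_expansion_const)

lemma gv_expansion:
  assumes l: "l < n" and r: "r < n"
  shows "relative_expansion (gv_names n) \<Omega> (\<lambda>\<Omega>. gv_matrix n \<Omega> $$ (l, r))
    (\<lambda>k. gv_gradient \<Omega> (gv_matrix n \<Omega>) k l r)"
proof -
  note param = logarithmic_expansion_param[OF finite_gv_names]
    and tan_sin = logarithmic_expansion_tan_sin[OF finite_gv_names]
  define i j where "i = Suc l" and "j = Suc r"
  have entry: "gv_matrix n \<Omega> $$ (l, r) = gv_entry n \<Omega> i j" for \<Omega>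
    using l r by (simp add: gv_matrix_def i_def j_def)
  have ij: "1 \<le> i" "i \<le> n" "1 \<le> j" "j \<le> n" using l r by (auto simp: i_def j_def)
  have part: "part (gv_matrix n \<Omega>) Q l r = (if Q i j then gv_entry n \<Omega> i j else 0)" for Q
    unfolding part_def entry by (simp add: i_def j_def)
  consider "i = j" | "j < i" | "i < j" by linarith
  then show ?thesis
  proof cases
    case 1
    have "logarithmic_expansion (gv_names n) \<Omega> (\<lambda>\<Omega>. \<Omega> (GV_d i)) (\<lambda>x. if x = GV_d i then 1 else 0)"
      by (rule param) (use ij in \<open>auto simp: gv_names_def\<close>)
    then have "logarithmic_expansion (gv_names n) \<Omega> (\<lambda>\<Omega>. gv_matrix n \<Omega> $$ (l, r)) (\<lambda>x. if x = GV_d i then 1 else 0)"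
      unfolding entry gv_entry_def using 1 by simp
    then show ?thesis
    proof (rule relative_expansion_cong)
      fix x assume "x \<in> gv_names n"
      show "gv_matrix n \<Omega> $$ (l, r) * (if x = GV_d i then 1 else 0) = gv_gradient \<Omega> (gv_matrix n \<Omega>) x l r"
        unfolding entry using 1 by (cases x) (auto simp: part)
    qed
  next
    case 2
    let ?e = "\<lambda>x. ((if x = GV_l i \<and> i \<noteq> n then - (tan_sin (\<Omega> (GV_l i)))\<^sup>2 else 0)
      + (\<Sum>k\<in>{j<..<i}. if x = GV_l k then (tan_cos (\<Omega> (GV_l k)))\<^sup>2 else 0))
      + (if x = GV_v j then 1 else 0)"
    have "logarithmic_expansion (gv_names n) \<Omega>
        (\<lambda>\<Omega>. gv_c n \<Omega> i * (\<Prod>k\<in>{j<..<i}. tan_sin (\<Omega> (GV_l k))) * \<Omega> (GV_v j)) ?e"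
      by (intro logarithmic_expansion_mult logarithmic_expansion_prod param tan_sin gv_c_expansion)
         (use ij 2 in \<open>auto simp: gv_names_def\<close>)
    then have "logarithmic_expansion (gv_names n) \<Omega> (\<lambda>\<Omega>. gv_matrix n \<Omega> $$ (l, r)) ?e"
      unfolding entry gv_entry_def gv_s_def using 2 by simp
    then show ?thesis
    proof (rule relative_expansion_cong)
      fix x assume x: "x \<in> gv_names n"
      show "gv_matrix n \<Omega> $$ (l, r) * ?e x = gv_gradient \<Omega> (gv_matrix n \<Omega>) x l r"
      proof (cases x)
        case (GV_l k)
        \<comment> \<open>The names \<open>GV_l k\<close> stop at \<open>n - 1\<close>, so the exception in the last row never concerns them.\<close>
        with x ij have "k = i \<Longrightarrow> i \<noteq> n" by (auto simp: gv_names_def)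
        then have "?e x = (if j < k \<and> k < i then (tan_cos (\<Omega> (GV_l k)))\<^sup>2 else 0)
            - (if k = i then (tan_sin (\<Omega> (GV_l k)))\<^sup>2 else 0)"
          using GV_l by auto
        then show ?thesis unfolding entry using 2 GV_l by (auto simp: part)
      qed (use 2 in \<open>auto simp: part entry\<close>)
    qed
  next
    case 3
    let ?e = "\<lambda>x. ((if x = GV_w i then 1 else 0)
      + (\<Sum>k\<in>{i<..<j}. if x = GV_u k then (tan_cos (\<Omega> (GV_u k)))\<^sup>2 else 0))
      + (if x = GV_u j \<and> j \<noteq> n then - (tan_sin (\<Omega> (GV_u j)))\<^sup>2 else 0)"
    have "logarithmic_expansion (gv_names n) \<Omega>
        (\<lambda>\<Omega>. \<Omega> (GV_w i) * (\<Prod>k\<in>{i<..<j}. tan_sin (\<Omega> (GV_u k))) * gv_r n \<Omega> j) ?e"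
      by (intro logarithmic_expansion_mult logarithmic_expansion_prod param tan_sin gv_r_expansion)
         (use ij 3 in \<open>auto simp: gv_names_def\<close>)
    then have "logarithmic_expansion (gv_names n) \<Omega> (\<lambda>\<Omega>. gv_matrix n \<Omega> $$ (l, r)) ?e"
      unfolding entry gv_entry_def gv_t_def using 3 by simp
    then show ?thesis
    proof (rule relative_expansion_cong)
      fix x assume x: "x \<in> gv_names n"
      show "gv_matrix n \<Omega> $$ (l, r) * ?e x = gv_gradient \<Omega> (gv_matrix n \<Omega>) x l r"
      proof (cases x)
        case (GV_u k)
        with x ij have "k = j \<Longrightarrow> j \<noteq> n" by (auto simp: gv_names_def)
        then have "?e x = (if i < k \<and> k < j then (tan_cos (\<Omega> (GV_u k)))\<^sup>2 else 0)
            - (if k = j then (tan_sin (\<Omega> (GV_u k)))\<^sup>2 else 0)"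
          using GV_u by auto
        then show ?thesis unfolding entry using 3 GV_u by (auto simp: part)
      qed (use 3 in \<open>auto simp: part entry\<close>)
    qed
  qed
qed

lemma sparse_expansion:
  assumes "i < n" "j < m"
  shows "relative_expansion {1..N} \<omega> (\<lambda>\<omega>. sparse_matrix n m N S \<omega> $$ (i, j)) (\<lambda>k. \<omega> k * S k $$ (i, j))"
  unfolding relative_expansion_def
proof (intro allI impI eventually_mono[OF eventually_at_right_less])
  fix e \<eta> :: real and \<epsilon> \<omega>' assume "e > 0" "0 < \<eta>" and p: "relatively_perturbed {1..N} \<omega> \<eta> \<epsilon> \<omega>'"
  have "(\<Sum>k = 1..N. \<omega>' k * S k $$ (i, j)) =
      (\<Sum>k = 1..N. \<omega> k * S k $$ (i, j) + \<epsilon> k * (\<omega> k * S k $$ (i, j)))"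
    using p by (intro sum.cong) (auto simp: relatively_perturbed_def algebra_simps)
  then have "sparse_matrix n m N S \<omega>' $$ (i, j) - sparse_matrix n m N S \<omega> $$ (i, j)
      - (\<Sum>k = 1..N. \<epsilon> k * (\<omega> k * S k $$ (i, j))) = 0"
    using assms by (simp add: sparse_matrix_def sum.distrib)
  then show "\<bar>sparse_matrix n m N S \<omega>' $$ (i, j) - sparse_matrix n m N S \<omega> $$ (i, j)
      - (\<Sum>k = 1..N. \<epsilon> k * (\<omega> k * S k $$ (i, j)))\<bar> \<le> e * \<eta>"
    using \<open>e > 0\<close> \<open>0 < \<eta>\<close> by simp
qed

section \<open>Comparison of the sensitivities\<close>

lemma response_diff:
  "response n P X i j (\<lambda>l r. a * Z l r - b * W l r) = a * response n P X i j Z - b * response n P X i j W"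
  unfolding response_def
  by (simp add: sum_distrib_left left_diff_distrib right_diff_distrib sum_subtractf mult_ac)

lemma response_part_split:
  assumes "\<And>i j. i \<in> {1..n} \<Longrightarrow> j \<in> {1..n} \<Longrightarrow> Q i j \<longleftrightarrow> Q1 i j \<or> Q2 i j"
    and "\<And>i j. \<not> (Q1 i j \<and> Q2 i j)"
  shows "response n P X i j (part A Q) = response n P X i j (part A Q1) + response n P X i j (part A Q2)"
proof -
  have "response n P X i j (part A Q) = response n P X i j (\<lambda>l r. part A Q1 l r + part A Q2 l r)"
    unfolding response_def
    by (intro sum.cong refl arg_cong2[where f = "(*)"]) (use assms in \<open>auto simp: part_def\<close>)
  then show ?thesis
    unfolding response_def by (simp add: distrib_left distrib_right sum.distrib)
qed

lemma response_part_cong: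
  assumes "\<And>i j. i \<in> {1..n} \<Longrightarrow> j \<in> {1..n} \<Longrightarrow> Q i j \<longleftrightarrow> Q' i j"
  shows "response n P X i j (part A Q) = response n P X i j (part A Q')"
  unfolding response_def
  by (intro sum.cong refl arg_cong2[where f = "(*)"]) (use assms in \<open>auto simp: part_def\<close>)

text \<open>
  \<open>R\<close>, \<open>B\<close>, \<open>C\<close> and \<open>H\<close> stand for the responses to rows, blocks, columns and corners of a
  triangle, and \<open>\<gamma>\<close> and \<open>\<sigma>\<close> for the squared cosines and sines. The weights \<open>\<sigma> k \<le> 1\<close> let the
  corners grow by no more than the inputs \<open>\<bar>G k\<bar>\<close> and \<open>\<bar>C k\<bar>\<close> in each step, and since
  \<open>\<gamma> k + \<sigma> k = 1\<close>, one corner pays for a row and a block together.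
\<close>

lemma corner_recursion_bound:
  fixes R B C H \<gamma> \<sigma> :: "nat \<Rightarrow> real"
  assumes n: "2 \<le> n"
    and \<gamma>: "\<And>k. \<gamma> k \<ge> 0" and \<sigma>: "\<And>k. \<sigma> k \<ge> 0" and \<gamma>\<sigma>: "\<And>k. \<gamma> k + \<sigma> k = 1"
    and HR: "\<And>k. 2 \<le> k \<Longrightarrow> k < n \<Longrightarrow> H k = R k + B k"
    and HS: "\<And>k. 2 \<le> k \<Longrightarrow> k < n \<Longrightarrow> H (Suc k) = B k + C k"
    and H2: "H 2 = C 1" and Hn: "H n = R n"
  shows "(\<Sum>k=2..n. \<bar>R k\<bar>) + (\<Sum>k=2..n-1. \<bar>B k\<bar>) + (\<Sum>k=1..n-1. \<bar>C k\<bar>)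
    \<le> (real n + 1) * ((\<Sum>k=2..n-1. \<bar>\<gamma> k * B k - \<sigma> k * R k\<bar>) + (\<Sum>k=1..n-1. \<bar>C k\<bar>))"
proof -
  define G where "G k = \<gamma> k * B k - \<sigma> k * R k" for k
  define T where "T = (\<Sum>k=2..n-1. \<bar>G k\<bar>) + (\<Sum>k=1..n-1. \<bar>C k\<bar>)"
  have B: "B k = \<sigma> k * H k + G k" and R: "R k = \<gamma> k * H k - G k" if "2 \<le> k" "k < n" for k
  proof -
    have \<gamma>k: "\<gamma> k = 1 - \<sigma> k" using \<gamma>\<sigma>[of k] by simp
    show "B k = \<sigma> k * H k + G k" "R k = \<gamma> k * H k - G k"
      unfolding HR[OF that] G_def \<gamma>k by (simp_all add: algebra_simps)
  qed
  have H: "\<bar>H k\<bar> \<le> (\<Sum>i=2..<k. \<bar>G i\<bar>) + (\<Sum>i=1..<k. \<bar>C i\<bar>)" if "2 \<le> k" "k \<le> n" for k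
    using that
  proof (induction k rule: dec_induct)
    case base
    have "{1..<2} = {1::nat}" by auto
    then show ?case by (simp add: H2)
  next
    case (step k)
    have "\<bar>\<sigma> k * H k\<bar> \<le> 1 * \<bar>H k\<bar>"
      unfolding abs_mult using \<gamma>[of k] \<sigma>[of k] \<gamma>\<sigma>[of k] by (intro mult_right_mono) auto
    then have "\<bar>H (Suc k)\<bar> \<le> \<bar>H k\<bar> + \<bar>G k\<bar> + \<bar>C k\<bar>"
      using step by (simp add: HS B)
    then show ?case using step by simp
  qed
  have HT: "\<bar>H k\<bar> \<le> T" if "2 \<le> k" "k \<le> n" for k
  proof -
    have "(\<Sum>i=2..<k. \<bar>G i\<bar>) \<le> (\<Sum>i=2..n-1. \<bar>G i\<bar>)" "(\<Sum>i=1..<k. \<bar>C i\<bar>) \<le> (\<Sum>i=1..n-1. \<bar>C i\<bar>)"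
      using that by (intro sum_mono2; auto)+
    with H[OF that] show ?thesis unfolding T_def by linarith
  qed
  have RB: "\<bar>R k\<bar> + \<bar>B k\<bar> \<le> T + 2 * \<bar>G k\<bar>" if "2 \<le> k" "k < n" for k
  proof -
    have "\<bar>R k\<bar> \<le> \<gamma> k * \<bar>H k\<bar> + \<bar>G k\<bar>" "\<bar>B k\<bar> \<le> \<sigma> k * \<bar>H k\<bar> + \<bar>G k\<bar>"
      unfolding B[OF that] R[OF that]
      using abs_triangle_ineq4[of "\<gamma> k * H k" "G k"] abs_triangle_ineq[of "\<sigma> k * H k" "G k"] \<gamma>[of k] \<sigma>[of k]
      by (auto simp: abs_mult)
    moreover have "\<gamma> k * \<bar>H k\<bar> + \<sigma> k * \<bar>H k\<bar> = \<bar>H k\<bar>"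
      unfolding distrib_right[symmetric] \<gamma>\<sigma> by simp
    ultimately show ?thesis using HT[of k] that by linarith
  qed
  have split: "{2..n} = insert n {2..n-1}" "n \<notin> {2..n-1}" using n by auto
  have "(\<Sum>k=2..n. \<bar>R k\<bar>) + (\<Sum>k=2..n-1. \<bar>B k\<bar>) = \<bar>R n\<bar> + (\<Sum>k=2..n-1. \<bar>R k\<bar> + \<bar>B k\<bar>)"
    using split by (simp add: sum.distrib)
  also have "\<dots> \<le> T + (\<Sum>k=2..n-1. T + 2 * \<bar>G k\<bar>)"
    using HT[of n] n unfolding Hn by (intro add_mono sum_mono RB) auto
  also have "\<dots> = (real n - 1) * T + 2 * (\<Sum>k=2..n-1. \<bar>G k\<bar>)"
  proof -
    have card: "real (card {2..n-1}) = real n - 2" using n by auto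
    show ?thesis
      by (simp only: sum.distrib sum_constant card sum_distrib_left[symmetric]) (simp add: algebra_simps)
  qed
  finally have "(\<Sum>k=2..n. \<bar>R k\<bar>) + (\<Sum>k=2..n-1. \<bar>B k\<bar>) + (\<Sum>k=1..n-1. \<bar>C k\<bar>)
      \<le> (real n - 1) * T + (2 * (\<Sum>k=2..n-1. \<bar>G k\<bar>) + (\<Sum>k=1..n-1. \<bar>C k\<bar>))" by linarith
  also have "\<dots> \<le> (real n - 1) * T + 2 * T"
  proof -
    have "2 * x + y \<le> 2 * (x + y)" if "0 \<le> y" for x y :: real
      using that by simp
    moreover have "0 \<le> (\<Sum>k=1..n-1. \<bar>C k\<bar>)" by (intro sum_nonneg) simp
    ultimately show ?thesis unfolding T_def by (intro add_left_mono)
  qed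
  also have "\<dots> = (real n + 1) * T" by (simp add: algebra_simps)
  finally show ?thesis unfolding T_def G_def .
qed

lemma row_block_bound:
  fixes R B \<gamma> \<sigma> :: "nat \<Rightarrow> real"
  assumes \<gamma>: "\<And>k. \<gamma> k \<ge> 0" and \<sigma>: "\<And>k. \<sigma> k \<ge> 0" and \<gamma>\<sigma>: "\<And>k. \<gamma> k + \<sigma> k = 1"
  shows "(\<Sum>k=2..n-1. \<bar>\<gamma> k * B k - \<sigma> k * R k\<bar>) \<le> (\<Sum>k=2..n. \<bar>R k\<bar>) + (\<Sum>k=2..n-1. \<bar>B k\<bar>)"
proof -
  have "\<bar>\<gamma> k * B k - \<sigma> k * R k\<bar> \<le> \<bar>R k\<bar> + \<bar>B k\<bar>" for k
  proof -
    have "\<bar>\<gamma> k * B k\<bar> \<le> 1 * \<bar>B k\<bar>" "\<bar>\<sigma> k * R k\<bar> \<le> 1 * \<bar>R k\<bar>"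
      unfolding abs_mult using \<gamma>[of k] \<sigma>[of k] \<gamma>\<sigma>[of k] by (intro mult_right_mono; simp)+
    then show ?thesis by linarith
  qed
  then have "(\<Sum>k=2..n-1. \<bar>\<gamma> k * B k - \<sigma> k * R k\<bar>) \<le> (\<Sum>k=2..n-1. \<bar>R k\<bar> + \<bar>B k\<bar>)"
    by (intro sum_mono)
  also have "\<dots> = (\<Sum>k=2..n-1. \<bar>R k\<bar>) + (\<Sum>k=2..n-1. \<bar>B k\<bar>)" by (rule sum.distrib)
  also have "(\<Sum>k=2..n-1. \<bar>R k\<bar>) \<le> (\<Sum>k=2..n. \<bar>R k\<bar>)" by (intro sum_mono2) auto
  finally show ?thesis by simp
qed

lemma sum_qs_names:
  fixes h :: "qs_name \<Rightarrow> real"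
  shows "sum h (qs_names n) = (\<Sum>k=2..n. h (QS_p k)) + (\<Sum>k=2..n-1. h (QS_a k)) + (\<Sum>k=1..n-1. h (QS_q k))
    + (\<Sum>k=1..n. h (QS_d k)) + (\<Sum>k=1..n-1. h (QS_g k)) + (\<Sum>k=2..n-1. h (QS_b k)) + (\<Sum>k=2..n. h (QS_h k))"
  unfolding qs_names_def
  by (subst sum.union_disjoint; (auto simp: sum.reindex inj_on_def)?)+

lemma sum_gv_names:
  fixes h :: "gv_name \<Rightarrow> real"
  shows "sum h (gv_names n) = (\<Sum>k=2..n-1. h (GV_l k)) + (\<Sum>k=1..n-1. h (GV_v k))
    + (\<Sum>k=1..n. h (GV_d k)) + (\<Sum>k=1..n-1. h (GV_w k)) + (\<Sum>k=2..n-1. h (GV_u k))"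
  unfolding gv_names_def
  by (subst sum.union_disjoint; (auto simp: sum.reindex inj_on_def)?)+

text \<open>
  The two triangles satisfy the same recursion with rows and columns exchanged; primes mark the
  upper one. The diagonal contributes equally to both sums.
\<close>

lemma response_sums_compare:
  fixes A P X :: "real mat" and \<Omega> :: "gv_name \<Rightarrow> real" and i j :: nat
  assumes n: "2 \<le> n"
  defines "gv \<equiv> (\<Sum>k\<in>gv_names n. \<bar>response n P X i j (gv_gradient \<Omega> A k)\<bar>)"
    and "qs \<equiv> (\<Sum>k\<in>qs_names n. \<bar>response n P X i j (qs_gradient A k)\<bar>)"
  shows "gv \<le> qs" "qs \<le> (real n + 1) * gv"
proof -
  define \<rho> where "\<rho> Q = response n P X i j (part A Q)" for Q
  define R B C H where "R k = \<rho> (\<lambda>i j. j < i \<and> i = k)" and "B k = \<rho> (\<lambda>i j. j < k \<and> k < i)"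
    and "C k = \<rho> (\<lambda>i j. j < i \<and> j = k)" and "H k = \<rho> (\<lambda>i j. j < k \<and> k \<le> i)" for k
  define R' B' C' H' where "R' k = \<rho> (\<lambda>i j. i < j \<and> j = k)" and "B' k = \<rho> (\<lambda>i j. i < k \<and> k < j)"
    and "C' k = \<rho> (\<lambda>i j. i < j \<and> i = k)" and "H' k = \<rho> (\<lambda>i j. i < k \<and> k \<le> j)" for k
  define D where "D = (\<Sum>k=1..n. \<bar>\<rho> (\<lambda>i j. i = k \<and> j = k)\<bar>)"
  define \<gamma> \<sigma> where "\<gamma> k = (tan_cos (\<Omega> (GV_l k)))\<^sup>2" and "\<sigma> k = (tan_sin (\<Omega> (GV_l k)))\<^sup>2" for k
  define \<gamma>' \<sigma>' where "\<gamma>' k = (tan_cos (\<Omega> (GV_u k)))\<^sup>2" and "\<sigma>' k = (tan_sin (\<Omega> (GV_u k)))\<^sup>2" for k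
  define c c' where "c = (\<Sum>k=1..n-1. \<bar>C k\<bar>)" and "c' = (\<Sum>k=1..n-1. \<bar>C' k\<bar>)"
  define b b' where "b = (\<Sum>k=2..n. \<bar>R k\<bar>) + (\<Sum>k=2..n-1. \<bar>B k\<bar>)"
    and "b' = (\<Sum>k=2..n. \<bar>R' k\<bar>) + (\<Sum>k=2..n-1. \<bar>B' k\<bar>)"
  define g g' where "g = (\<Sum>k=2..n-1. \<bar>\<gamma> k * B k - \<sigma> k * R k\<bar>)"
    and "g' = (\<Sum>k=2..n-1. \<bar>\<gamma>' k * B' k - \<sigma>' k * R' k\<bar>)"
  have qs: "qs = b + c + D + (b' + c')"
    unfolding qs_def sum_qs_names by (simp add: b_def b'_def c_def c'_def D_def \<rho>_def R_def B_def C_def R'_def B'_def C'_def)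
  have gv: "gv = g + c + D + (g' + c')"
    unfolding gv_def sum_gv_names
    by (simp add: response_diff g_def g'_def c_def c'_def D_def \<rho>_def R_def B_def C_def R'_def B'_def C'_def
        \<gamma>_def \<sigma>_def \<gamma>'_def \<sigma>'_def)
  have unit: "\<gamma> k \<ge> 0" "\<sigma> k \<ge> 0" "\<gamma> k + \<sigma> k = 1" "\<gamma>' k \<ge> 0" "\<sigma>' k \<ge> 0" "\<gamma>' k + \<sigma>' k = 1" for k
    by (simp_all add: \<gamma>_def \<sigma>_def \<gamma>'_def \<sigma>'_def tan_cos_sin_squares)
  have "g \<le> b" "g' \<le> b'"
    unfolding g_def b_def g'_def b'_def by (rule row_block_bound; rule unit)+
  then show "gv \<le> qs" unfolding gv qs by simp
  have lower: "b + c \<le> (real n + 1) * (g + c)"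
    unfolding b_def c_def g_def
  proof (rule corner_recursion_bound[OF n unit(1-3)])
    show "H k = R k + B k" "H (Suc k) = B k + C k" for k
      unfolding H_def R_def B_def C_def \<rho>_def by (rule response_part_split; auto)+
    show "H 2 = C 1" "H n = R n"
      unfolding H_def C_def R_def \<rho>_def by (rule response_part_cong; auto)+
  qed
  have upper: "b' + c' \<le> (real n + 1) * (g' + c')"
    unfolding b'_def c'_def g'_def
  proof (rule corner_recursion_bound[OF n unit(4-6)])
    show "H' k = R' k + B' k" "H' (Suc k) = B' k + C' k" for k
      unfolding H'_def R'_def B'_def C'_def \<rho>_def by (rule response_part_split; auto)+
    show "H' 2 = C' 1" "H' n = R' n"
      unfolding H'_def C'_def R'_def \<rho>_def by (rule response_part_cong; auto)+
  qed
  have "D \<le> (real n + 1) * D"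
    using mult_right_mono[of 1 "real n + 1" D] by (simp add: D_def sum_nonneg)
  with lower upper show "qs \<le> (real n + 1) * gv"
    unfolding gv qs distrib_left by linarith
qed

theorem theorem5p1:
  fixes n m M :: nat
    and A B X :: "real mat"
    and S :: "nat \<Rightarrow> real mat"
    and \<Omega>QS :: "qs_name \<Rightarrow> real"
    and \<Omega>GV :: "gv_name \<Rightarrow> real"
    and \<Omega>B :: "nat \<Rightarrow> real"
  assumes "n \<ge> 2" and "m \<ge> 1"
    and "A \<in> carrier_mat n n" and "X \<in> carrier_mat n m" and "B \<in> carrier_mat n m"
    and "A * X = B"
    and "\<And>i j. i < n \<Longrightarrow> j < m \<Longrightarrow> X $$ (i, j) \<noteq> 0"
    and "invertible_mat A"
    and "quasiseparable n A"
    and "gv_representation n A \<Omega>GV"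
    and "qs_representation n A \<Omega>QS"
    and "\<And>k. k \<in> {1..M} \<Longrightarrow> S k \<in> carrier_mat n m"
    and "B = sparse_matrix n m M S \<Omega>B"
  shows "cond_GV n m \<Omega>GV M S \<Omega>B X \<le> cond_QS n m \<Omega>QS M S \<Omega>B X
       \<and> cond_QS n m \<Omega>QS M S \<Omega>B X \<le> ereal (3 * real n - 2) * cond_GV n m \<Omega>GV M S \<Omega>B X"
proof -
  have qsA: "qs_matrix n \<Omega>QS = A" and gvA: "gv_matrix n \<Omega>GV = A"
    using assms by (auto simp: qs_representation_def gv_representation_def)
  obtain P where P: "P \<in> carrier_mat n n" "P * A = 1\<^sub>m n"
  proof -
    obtain P where P: "A * P = 1\<^sub>m (dim_row A)" "P * A = 1\<^sub>m (dim_row P)"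
      using assms(8) by (auto simp: invertible_mat_def inverts_mat_def)
    from arg_cong[OF P(1), of dim_col] arg_cong[OF P(2), of dim_col] assms(3)
    have "dim_col P = n" "dim_row P = n" by auto
    with P(2) show ?thesis by (intro that) auto
  qed
  have "0 < \<bar>X $$ (0, 0)\<bar>" using assms by simp
  also have "\<dots> \<le> max_norm X" using assms by (intro abs_entry_le_max_norm[OF assms(4)]) auto
  finally have X: "max_norm X > 0" .
  interpret qs: perturbed_system n m "qs_names n" "qs_matrix n" \<Omega>QS "{1..M}" "sparse_matrix n m M S" \<Omega>B
    X P "qs_gradient A" "\<lambda>k i j. \<Omega>B k * S k $$ (i, j)"
  proof
    show "0 < n" "0 < m" using assms by auto
    show "qs_matrix n \<Omega> \<in> carrier_mat n n" for \<Omega> by (simp add: qs_matrix_def)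
    show "sparse_matrix n m M S \<omega> \<in> carrier_mat n m" for \<omega> by (simp add: sparse_matrix_def)
    show "X \<in> carrier_mat n m" "max_norm X > 0" "P \<in> carrier_mat n n" by fact+
    show "P * qs_matrix n \<Omega>QS = 1\<^sub>m n" "qs_matrix n \<Omega>QS * X = sparse_matrix n m M S \<Omega>B"
      unfolding qsA using P assms by simp_all
  qed (use qs_expansion[of _ n _ \<Omega>QS] sparse_expansion in \<open>simp_all add: qsA\<close>)
  interpret gv: perturbed_system n m "gv_names n" "gv_matrix n" \<Omega>GV "{1..M}" "sparse_matrix n m M S" \<Omega>B
    X P "gv_gradient \<Omega>GV A" "\<lambda>k i j. \<Omega>B k * S k $$ (i, j)"
  proof
    show "0 < n" "0 < m" using assms by auto
    show "gv_matrix n \<Omega> \<in> carrier_mat n n" for \<Omega> by (simp add: gv_matrix_def)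
    show "sparse_matrix n m M S \<omega> \<in> carrier_mat n m" for \<omega> by (simp add: sparse_matrix_def)
    show "X \<in> carrier_mat n m" "max_norm X > 0" "P \<in> carrier_mat n n" by fact+
    show "P * gv_matrix n \<Omega>GV = 1\<^sub>m n" "gv_matrix n \<Omega>GV * X = sparse_matrix n m M S \<Omega>B"
      unfolding gvA using P assms by simp_all
  qed (use gv_expansion[of _ n _ \<Omega>GV] sparse_expansion in \<open>simp_all add: gvA\<close>)
  have le: "gv.sensitivity i j \<le> qs.sensitivity i j"
    and ge: "qs.sensitivity i j \<le> (3 * real n - 2) * gv.sensitivity i j" for i j
  proof -
    note compare = response_sums_compare[OF assms(1), where P = P and X = X and i = i and j = j and \<Omega> = \<Omega>GV and A = A]
    define s t u where "s = (\<Sum>k\<in>gv_names n. \<bar>response n P X i j (gv_gradient \<Omega>GV A k)\<bar>)"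
      and "t = (\<Sum>k\<in>qs_names n. \<bar>response n P X i j (qs_gradient A k)\<bar>)"
      and "u = (\<Sum>k = 1..M. \<bar>gv.rhs_response i j k\<bar>)"
    have gv: "gv.sensitivity i j = s + u" and qs: "qs.sensitivity i j = t + u"
      unfolding gv.sensitivity_def qs.sensitivity_def by (simp_all add: s_def t_def u_def)
    show "gv.sensitivity i j \<le> qs.sensitivity i j"
      using compare(1) unfolding gv qs s_def t_def by simp
    have su: "s \<ge> 0" "u \<ge> 0" by (simp_all add: s_def u_def sum_nonneg)
    have "t \<le> (real n + 1) * s" using compare(2) unfolding s_def t_def .
    also have "\<dots> \<le> (3 * real n - 2) * s" using assms(1) su by (intro mult_right_mono) auto
    moreover have "1 * u \<le> (3 * real n - 2) * u" using assms(1) su by (intro mult_right_mono) auto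
    ultimately show "qs.sensitivity i j \<le> (3 * real n - 2) * gv.sensitivity i j"
      unfolding gv qs distrib_left by simp
  qed
  have "gv.max_sensitivity \<le> qs.max_sensitivity"
  proof -
    obtain i j where ij: "i < n" "j < m" "gv.max_sensitivity = gv.sensitivity i j"
      by (rule gv.max_sensitivity_attained)
    show ?thesis unfolding ij(3) using le qs.sensitivity_le_max[OF ij(1,2)] by (rule order_trans)
  qed
  then have "gv.max_sensitivity / max_norm X \<le> qs.max_sensitivity / max_norm X"
    using X by (intro divide_right_mono) auto
  moreover have "qs.max_sensitivity \<le> (3 * real n - 2) * gv.max_sensitivity"
  proof -
    obtain i j where ij: "i < n" "j < m" "qs.max_sensitivity = qs.sensitivity i j"
      by (rule qs.max_sensitivity_attained)
    have "(3 * real n - 2) * gv.sensitivity i j \<le> (3 * real n - 2) * gv.max_sensitivity"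
      using assms(1) gv.sensitivity_le_max[OF ij(1,2)] by (intro mult_left_mono) auto
    with ge[of i j] show ?thesis unfolding ij(3) by (rule order_trans)
  qed
  then have "qs.max_sensitivity / max_norm X \<le> (3 * real n - 2) * gv.max_sensitivity / max_norm X"
    using X by (intro divide_right_mono) auto
  ultimately show ?thesis
    unfolding cond_GV_def cond_QS_def gv.cond_number_eq qs.cond_number_eq
    by simp
qed

end
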